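(* Let $T$ be a sound LPAD with the bounded term-size property, and let $A$ be a ground atom in the Herbrand base $\mathcal{H}_T$. Then $A$ has a finite set of finite explanations that is covering with respect to $A$.
   Context: Programs are over a first-order language with finitely many function and constant symbols (possibly including non-constant function symbols). Normal programs and well-founded semantics: a normal program is a set of clauses $B\leftarrow L_1,\ldots,L_n$ ($B$ an atom, $L_i$ literals). For a 3-valued interpretation $I=\langle Tr;Fa\rangle$ (atom $A$ true in $I$ iff $A\in Tr$, false iff $A\in Fa$; $\neg A$ true iff $A$ false and false iff $A$ true), define $True^P_I(Tr)=\{A\mid A$ not true in $I$ and there is a clause $B\leftarrow L_1,\ldots,L_n$ of $P$ and ground substitution $\theta$ with $A=B\theta$ and each $L_i\theta$ true in $I$ or in $Tr\}$ and $False^P_I(Fa)=\{A\mid A$ not false in $I$ and for every clause $B\leftarrow L_1,\ldots,L_n$ and ground $\theta$ with $A=B\theta$ some $L_i\theta$ is false in $I$ or in $Fa\}$. Let $\mathcal{T}_I$ be the least fixed point of $True^P_I$ and $\mathcal{F}_I$ the greatest fixed point of $False^P_I$. Set $WFM_0=\langle\emptyset;\emptyset\rangle$, $WFM_{\alpha+1}=WFM_\alpha\cup\langle\mathcal{T}_{WFM_\alpha};\mathcal{F}_{WFM_\alpha}\rangle$, unions at limits; $WFM(P)$, the well-founded model, is $WFM_\delta$ for the least $\delta$ with $\mathcal{T}_{WFM_\delta}=\mathcal{F}_{WFM_\delta}=\emptyset$. An application of $True^P_I(Tr)$ has the bounded term-size property if there is an integer $L$ bounding the size of every ground substitution $\theta$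 used to produce an atom of $True^P_I(Tr)$; $P$ has the bounded term-size property if every application of $True^P_I$ used to construct $WFM(P)$ has this property with the same bound $L$. LPADs: a Logic Program with Annotated Disjunctions is a finite set of clauses $C = H_1:\alpha_1\vee\cdots\vee H_n:\alpha_n\leftarrow L_1,\ldots,L_m$ with atoms $H_j$, literals $L_i$, and $\alpha_j\in[0,1]$ with $\sum_j\alpha_j\le 1$; if $\sum_j\alpha_j<1$ the head implicitly contains an extra atom $null$ (appearing in no body) with annotation $1-\sum_j\alpha_j$. $head(C)$ is the resulting set of annotated atoms, $H_i(C)$ the $i$-th head atom, $body(C)$ the body. An atomic choice is a triple $(C,\theta,i)$ with $C\in T$, $\theta$ a minimal substitution grounding $C$, and $i\in\{1,\ldots,|head(C)|\}$. A composite choice is a set of atomic choices that is consistent (never contains $(C,\theta,i)$ and $(C,\theta,j)$ with $i\ne j$). A selection $\sigma$ is a composite choice containing an atomic choice $(C,\theta,i)$ for every ground instance $C\theta$ of every clause of $T$; it determines the world $w_\sigma=\{H_i(C)\theta\leftarrow body(C)\theta \mid (C,\theta,i)\in\sigma\}$, a normal program. For a composite choice $\kappa$, $\omega_\kappa$ is the set of worlds $w_\sigma$ with $\sigma\supseteq\kappa$, and for a set $K$ of composite choices $\omega_K=\bigcup_{\kappa\in K}\omega_\kappa$. $T$ is sound if every world has a two-valued (total) well-founded model. $T$ has the bounded term-size property if each of its worlds has the bounded term-size property. A composite choice $\kappa$ is an explanation for a ground atom $A$ if $A$ is true in the well-founded model of every world in $\omega_\kappa$; it is finite if it is a finite set.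 A set $K$ of composite choices is covering with respect to $A$ if every world in whose well-founded model $A$ is true belongs to $\omega_K$. *)

theory Defs
  imports Complex_Main
begin

datatype ('f, 'v) trm = Var 'v | Fn 'f "('f, 'v) trm list"

text \<open>Atoms; Null is the special atom null of LPAD heads (it never occurs in bodies).\<close>
datatype ('p, 'f, 'v) atom = Atom 'p "('f, 'v) trm list" | Null

datatype ('p, 'f, 'v) lit = Pos "('p, 'f, 'v) atom" | Neg "('p, 'f, 'v) atom"

type_synonym ('p, 'f, 'v) nclause = "('p, 'f, 'v) atom \<times> ('p, 'f, 'v) lit list"
type_synonym ('p, 'f, 'v) nprog = "('p, 'f, 'v) nclause set"

type_synonym ('p, 'f, 'v) lpad_clause =
  "(('p, 'f, 'v) atom \<times> real) list \<times> ('p, 'f, 'v) lit list"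
type_synonym ('p, 'f, 'v) lpad = "('p, 'f, 'v) lpad_clause set"

fun vars_trm :: "('f, 'v) trm \<Rightarrow> 'v set" where
  "vars_trm (Var x) = {x}"
| "vars_trm (Fn f ts) = (\<Union>t\<in>set ts. vars_trm t)"

fun subst_trm :: "('v \<Rightarrow> ('f, 'v) trm) \<Rightarrow> ('f, 'v) trm \<Rightarrow> ('f, 'v) trm" where
  "subst_trm \<theta> (Var x) = \<theta> x"
| "subst_trm \<theta> (Fn f ts) = Fn f (map (subst_trm \<theta>) ts)"

fun wf_trm :: "('f \<Rightarrow> nat) \<Rightarrow> ('f, 'v) trm \<Rightarrow> bool" where
  "wf_trm fa (Var x) = True"
| "wf_trm fa (Fn f ts) = (length ts = fa f \<and> (\<forall>t\<in>set ts. wf_trm fa t))"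

fun tsize :: "('f, 'v) trm \<Rightarrow> nat" where
  "tsize (Var x) = 1"
| "tsize (Fn f ts) = Suc (sum_list (map tsize ts))"

definition HU :: "('f \<Rightarrow> nat) \<Rightarrow> ('f, 'v) trm set" where
  "HU fa = {t. vars_trm t = {} \<and> wf_trm fa t}"

fun atom_terms :: "('p, 'f, 'v) atom \<Rightarrow> ('f, 'v) trm list" where
  "atom_terms (Atom p ts) = ts"
| "atom_terms Null = []"

fun subst_atom :: "('v \<Rightarrow> ('f, 'v) trm) \<Rightarrow> ('p, 'f, 'v) atom \<Rightarrow> ('p, 'f, 'v) atom" where
  "subst_atom \<theta> (Atom p ts) = Atom p (map (subst_trm \<theta>) ts)"
| "subst_atom \<theta> Null = Null"

fun lit_atom :: "('p, 'f, 'v) lit \<Rightarrow> ('p, 'f, 'v) atom" where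
  "lit_atom (Pos a) = a"
| "lit_atom (Neg a) = a"

fun subst_lit :: "('v \<Rightarrow> ('f, 'v) trm) \<Rightarrow> ('p, 'f, 'v) lit \<Rightarrow> ('p, 'f, 'v) lit" where
  "subst_lit \<theta> (Pos a) = Pos (subst_atom \<theta> a)"
| "subst_lit \<theta> (Neg a) = Neg (subst_atom \<theta> a)"

definition vars_atom :: "('p, 'f, 'v) atom \<Rightarrow> 'v set" where
  "vars_atom a = (\<Union>t\<in>set (atom_terms a). vars_trm t)"

definition wf_atom :: "('f \<Rightarrow> nat) \<Rightarrow> ('p, 'f, 'v) atom \<Rightarrow> bool" where
  "wf_atom fa a = (\<forall>t\<in>set (atom_terms a). wf_trm fa t)"

definition gatoms :: "('f \<Rightarrow> nat) \<Rightarrow> ('p, 'f, 'v) atom set" where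
  "gatoms fa = {a. vars_atom a = {} \<and> wf_atom fa a}"

definition clause_vars :: "('p, 'f, 'v) nclause \<Rightarrow> 'v set" where
  "clause_vars C = vars_atom (fst C) \<union> (\<Union>l\<in>set (snd C). vars_atom (lit_atom l))"

definition subst_clause ::
  "('v \<Rightarrow> ('f, 'v) trm) \<Rightarrow> ('p, 'f, 'v) nclause \<Rightarrow> ('p, 'f, 'v) nclause" where
  "subst_clause \<theta> C = (subst_atom \<theta> (fst C), map (subst_lit \<theta>) (snd C))"

definition clause_size :: "('p, 'f, 'v) nclause \<Rightarrow> nat" where
  "clause_size C = Max (insert 0 (tsize ` (set (atom_terms (fst C)) \<union>
                       (\<Union>l\<in>set (snd C). set (atom_terms (lit_atom l))))))"

definition grounding_subst :: "('f \<Rightarrow> nat) \<Rightarrow> 'v set \<Rightarrow> ('v \<Rightarrow> ('f, 'v) trm) \<Rightarrow> bool" where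
  "grounding_subst fa vs \<theta> = ((\<forall>x\<in>vs. \<theta> x \<in> HU fa) \<and> (\<forall>x. x \<notin> vs \<longrightarrow> \<theta> x = Var x))"

type_synonym ('p, 'f, 'v) interp = "('p, 'f, 'v) atom set \<times> ('p, 'f, 'v) atom set"

fun lit_true :: "('p, 'f, 'v) interp \<Rightarrow> ('p, 'f, 'v) lit \<Rightarrow> bool" where
  "lit_true I (Pos a) = (a \<in> fst I)"
| "lit_true I (Neg a) = (a \<in> snd I)"

fun lit_false :: "('p, 'f, 'v) interp \<Rightarrow> ('p, 'f, 'v) lit \<Rightarrow> bool" where
  "lit_false I (Pos a) = (a \<in> snd I)"
| "lit_false I (Neg a) = (a \<in> fst I)"

text \<open>True^P_I(Tr); "true in Tr" means true in the interpretation <Tr; {}>.\<close>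
definition TrueOp :: "('f \<Rightarrow> nat) \<Rightarrow> ('p, 'f, 'v) nprog \<Rightarrow> ('p, 'f, 'v) interp
    \<Rightarrow> ('p, 'f, 'v) atom set \<Rightarrow> ('p, 'f, 'v) atom set" where
  "TrueOp fa P I Tr = {A. A \<notin> fst I \<and>
     (\<exists>C\<in>P. \<exists>\<theta>. grounding_subst fa (clause_vars C) \<theta> \<and> A = subst_atom \<theta> (fst C) \<and>
        (\<forall>l\<in>set (snd C). lit_true I (subst_lit \<theta> l) \<or> lit_true (Tr, {}) (subst_lit \<theta> l)))}"

text \<open>False^P_I(Fa); "false in Fa" means false in the interpretation <{}; Fa>.\<close>
definition FalseOp :: "('f \<Rightarrow> nat) \<Rightarrow> ('p, 'f, 'v) nprog \<Rightarrow> ('p, 'f, 'v) interp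
    \<Rightarrow> ('p, 'f, 'v) atom set \<Rightarrow> ('p, 'f, 'v) atom set" where
  "FalseOp fa P I Fa = {A \<in> gatoms fa. A \<notin> snd I \<and>
     (\<forall>C\<in>P. \<forall>\<theta>. grounding_subst fa (clause_vars C) \<theta> \<and> A = subst_atom \<theta> (fst C) \<longrightarrow>
        (\<exists>l\<in>set (snd C). lit_false I (subst_lit \<theta> l) \<or> lit_false ({}, Fa) (subst_lit \<theta> l)))}"

definition wfm_step :: "('f \<Rightarrow> nat) \<Rightarrow> ('p, 'f, 'v) nprog \<Rightarrow> ('p, 'f, 'v) interp
    \<Rightarrow> ('p, 'f, 'v) interp" where
  "wfm_step fa P I = (fst I \<union> lfp (TrueOp fa P I), snd I \<union> gfp (FalseOp fa P I))"

definition interp_chain :: "('p, 'f, 'v) interp set \<Rightarrow> bool" where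
  "interp_chain S = (\<forall>I\<in>S. \<forall>J\<in>S. (fst I \<subseteq> fst J \<and> snd I \<subseteq> snd J) \<or>
                                   (fst J \<subseteq> fst I \<and> snd J \<subseteq> snd I))"

text \<open>The stages WFM_alpha of the transfinite construction: the smallest family containing
  <{};{}>, closed under the successor step and under unions of chains (limit stages).\<close>
inductive wfm_stage :: "('f \<Rightarrow> nat) \<Rightarrow> ('p, 'f, 'v) nprog \<Rightarrow> ('p, 'f, 'v) interp \<Rightarrow> bool"
  for fa P where
  zero: "wfm_stage fa P ({}, {})"
| succ: "wfm_stage fa P I \<Longrightarrow> wfm_stage fa P (wfm_step fa P I)"
| lim: "interp_chain S \<Longrightarrow> (\<forall>I\<in>S. wfm_stage fa P I) \<Longrightarrow>
        wfm_stage fa P (\<Union>(fst ` S), \<Union>(snd ` S))"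

text \<open>The well-founded model: the stage at which T_I and F_I are empty (the stage fixed by the step).\<close>
definition WFM :: "('f \<Rightarrow> nat) \<Rightarrow> ('p, 'f, 'v) nprog \<Rightarrow> ('p, 'f, 'v) interp" where
  "WFM fa P = (THE I. wfm_stage fa P I \<and> wfm_step fa P I = I)"

text \<open>Bounded term-size property of a normal program: one bound L on the size of the ground
  clause instances used in all applications True^P_I(Tr) made in constructing WFM(P)
  (I a stage, Tr an iterate of True^P_I towards its least fixed point).\<close>
definition bounded_term_size :: "('f \<Rightarrow> nat) \<Rightarrow> ('p, 'f, 'v) nprog \<Rightarrow> bool" where
  "bounded_term_size fa P = (\<exists>L::nat. \<forall>I n. wfm_stage fa P I \<longrightarrow>
     (\<forall>C\<in>P. \<forall>\<theta>. grounding_subst fa (clause_vars C) \<theta> \<and> subst_atom \<theta> (fst C) \<notin> fst I \<and>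
        (\<forall>l\<in>set (snd C). lit_true I (subst_lit \<theta> l) \<or>
                           lit_true ((TrueOp fa P I ^^ n) {}, {}) (subst_lit \<theta> l))
        \<longrightarrow> clause_size (subst_clause \<theta> C) \<le> L))"

definition lpad_heads :: "('p, 'f, 'v) lpad_clause \<Rightarrow> ('p, 'f, 'v) atom list" where
  "lpad_heads C = map fst (fst C) @ (if sum_list (map snd (fst C)) < 1 then [Null] else [])"

definition lpad_atoms :: "('p, 'f, 'v) lpad_clause \<Rightarrow> ('p, 'f, 'v) atom set" where
  "lpad_atoms C = fst ` set (fst C) \<union> lit_atom ` set (snd C)"

definition lpad_vars :: "('p, 'f, 'v) lpad_clause \<Rightarrow> 'v set" where
  "lpad_vars C = (\<Union>a\<in>lpad_atoms C. vars_atom a)"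

definition wf_lpad :: "('f \<Rightarrow> nat) \<Rightarrow> ('p, 'f, 'v) lpad \<Rightarrow> bool" where
  "wf_lpad fa T = (finite T \<and> (\<forall>C\<in>T.
     (\<forall>(h, \<alpha>)\<in>set (fst C). 0 \<le> \<alpha> \<and> \<alpha> \<le> 1) \<and> sum_list (map snd (fst C)) \<le> 1 \<and>
     (\<forall>a\<in>lpad_atoms C. a \<noteq> Null \<and> wf_atom fa a)))"

definition atomic_choice :: "('f \<Rightarrow> nat) \<Rightarrow> ('p, 'f, 'v) lpad
    \<Rightarrow> ('p, 'f, 'v) lpad_clause \<times> ('v \<Rightarrow> ('f, 'v) trm) \<times> nat \<Rightarrow> bool" where
  "atomic_choice fa T c = (case c of (C, \<theta>, i) \<Rightarrow>
     C \<in> T \<and> grounding_subst fa (lpad_vars C) \<theta> \<and> i < length (lpad_heads C))"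

definition composite_choice :: "('f \<Rightarrow> nat) \<Rightarrow> ('p, 'f, 'v) lpad
    \<Rightarrow> (('p, 'f, 'v) lpad_clause \<times> ('v \<Rightarrow> ('f, 'v) trm) \<times> nat) set \<Rightarrow> bool" where
  "composite_choice fa T \<kappa> = ((\<forall>c\<in>\<kappa>. atomic_choice fa T c) \<and>
     (\<forall>C \<theta> i j. (C, \<theta>, i) \<in> \<kappa> \<and> (C, \<theta>, j) \<in> \<kappa> \<longrightarrow> i = j))"

definition selection :: "('f \<Rightarrow> nat) \<Rightarrow> ('p, 'f, 'v) lpad
    \<Rightarrow> (('p, 'f, 'v) lpad_clause \<times> ('v \<Rightarrow> ('f, 'v) trm) \<times> nat) set \<Rightarrow> bool" where
  "selection fa T \<sigma> = (composite_choice fa T \<sigma> \<and>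
     (\<forall>C\<in>T. \<forall>\<theta>. grounding_subst fa (lpad_vars C) \<theta> \<longrightarrow> (\<exists>i. (C, \<theta>, i) \<in> \<sigma>)))"

definition world :: "(('p, 'f, 'v) lpad_clause \<times> ('v \<Rightarrow> ('f, 'v) trm) \<times> nat) set
    \<Rightarrow> ('p, 'f, 'v) nprog" where
  "world \<sigma> = {(subst_atom \<theta> (lpad_heads C ! i), map (subst_lit \<theta>) (snd C)) | C \<theta> i.
                (C, \<theta>, i) \<in> \<sigma>}"

definition worlds :: "('f \<Rightarrow> nat) \<Rightarrow> ('p, 'f, 'v) lpad \<Rightarrow> ('p, 'f, 'v) nprog set" where
  "worlds fa T = {world \<sigma> | \<sigma>. selection fa T \<sigma>}"

definition omega :: "('f \<Rightarrow> nat) \<Rightarrow> ('p, 'f, 'v) lpad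
    \<Rightarrow> (('p, 'f, 'v) lpad_clause \<times> ('v \<Rightarrow> ('f, 'v) trm) \<times> nat) set \<Rightarrow> ('p, 'f, 'v) nprog set" where
  "omega fa T \<kappa> = {world \<sigma> | \<sigma>. selection fa T \<sigma> \<and> \<kappa> \<subseteq> \<sigma>}"

definition sound_lpad :: "('f \<Rightarrow> nat) \<Rightarrow> ('p, 'f, 'v) lpad \<Rightarrow> bool" where
  "sound_lpad fa T = (\<forall>w\<in>worlds fa T. gatoms fa \<subseteq> fst (WFM fa w) \<union> snd (WFM fa w))"

definition lpad_bounded_term_size :: "('f \<Rightarrow> nat) \<Rightarrow> ('p, 'f, 'v) lpad \<Rightarrow> bool" where
  "lpad_bounded_term_size fa T = (\<forall>w\<in>worlds fa T. bounded_term_size fa w)"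

definition explanation :: "('f \<Rightarrow> nat) \<Rightarrow> ('p, 'f, 'v) lpad
    \<Rightarrow> (('p, 'f, 'v) lpad_clause \<times> ('v \<Rightarrow> ('f, 'v) trm) \<times> nat) set
    \<Rightarrow> ('p, 'f, 'v) atom \<Rightarrow> bool" where
  "explanation fa T \<kappa> A = (composite_choice fa T \<kappa> \<and>
     (\<forall>w\<in>omega fa T \<kappa>. A \<in> fst (WFM fa w)))"

definition covering :: "('f \<Rightarrow> nat) \<Rightarrow> ('p, 'f, 'v) lpad
    \<Rightarrow> (('p, 'f, 'v) lpad_clause \<times> ('v \<Rightarrow> ('f, 'v) trm) \<times> nat) set set
    \<Rightarrow> ('p, 'f, 'v) atom \<Rightarrow> bool" where
  "covering fa T K A = (\<forall>w\<in>worlds fa T. A \<in> fst (WFM fa w) \<longrightarrow> w \<in> (\<Union>\<kappa>\<in>K. omega fa T \<kappa>))"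

definition herbrand_base :: "('f \<Rightarrow> nat) \<Rightarrow> ('p, 'f, 'v) lpad \<Rightarrow> ('p, 'f, 'v) atom set" where
  "herbrand_base fa T = {Atom p ts | p ts. (\<forall>t\<in>set ts. t \<in> HU fa) \<and>
     (\<exists>C\<in>T. \<exists>us. Atom p us \<in> lpad_atoms C \<and> length us = length ts)}"

end

theory Submission
  imports Defs "HOL-Library.Product_Order" "HOL-Library.Infinite_Set"
    "HOL-Analysis.Function_Topology"
begin

text \<open>
  By soundness the true atoms of a world form its unique stable model, so it suffices to control
  stable models. Let \<open>S\<close> be the stable model of the world of a selection \<open>f\<close>; it is finite by the
  bounded term-size property. A selection that agrees with \<open>f\<close> on the instances whose body is true
  in \<open>S\<close> has the same stable model. In fact agreement on a finite set of instances is enough: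
  those supporting the atoms of \<open>S\<close>, and those with true body that have a head outside \<open>S\<close>. There are
  only finitely many of the latter; otherwise, since one may flip infinitely many choices at
  once, there are instances of one clause whose heads all coincide and whose bodies differ only
  in negative literals. Such instances with unboundedly large bodies are still
  harmless for the term-size bound if their common head was derived at an earlier stage, so
  the flipped set has to be chosen inside the first infinite batch of instances whose bodies
  become true in a partial construction in which the new head is never assumed false.
  Finally, each selection is determined up to its model by finitely many choices, and the space
  of selections is compact.
\<close>

section \<open>Homogeneous infinite subsets and compactness of the space of selections\<close>

lemma infinite_subset_const_or_inj_on:
  assumes "finite G" "infinite N"
  obtains M where "M \<subseteq> N" "infinite M"
    "\<And>g. g \<in> G \<Longrightarrow> (\<forall>x\<in>M. \<forall>y\<in>M. g x = g y) \<or> inj_on g M"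
proof -
  have "\<exists>M\<subseteq>N. infinite M \<and> (\<forall>g\<in>G. (\<forall>x\<in>M. \<forall>y\<in>M. g x = g y) \<or> inj_on g M)"
    using assms
  proof (induction G)
    case empty
    then show ?case by blast
  next
    case (insert g G)
    then obtain M where M: "M \<subseteq> N" "infinite M"
      "\<forall>h\<in>G. (\<forall>x\<in>M. \<forall>y\<in>M. h x = h y) \<or> inj_on h M"
      by auto
    \<comment> \<open>If \<open>g\<close> has finite range on \<open>M\<close>, some fibre is
      infinite; otherwise one representative per value gives an infinite set on which
      \<open>g\<close> is injective. Both alternatives survive passing to subsets, so the functions
      can be treated one at a time.\<close>
    obtain M' where M': "M' \<subseteq> M" "infinite M'"
      "(\<forall>x\<in>M'. \<forall>y\<in>M'. g x = g y) \<or> inj_on g M'"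
    proof (cases "finite (g ` M)")
      case True
      then obtain x where "x \<in> M" "infinite {y \<in> M. g y = g x}"
        using pigeonhole_infinite[OF M(2)] by blast
      then show ?thesis
        by (intro that[of "{y \<in> M. g y = g x}"]) auto
    next
      case False
      obtain M' where "M' \<subseteq> M" "inj_on g M'" "g ` M = g ` M'"
        by (metis subset_image_inj subset_refl)
      then show ?thesis
        using False by (intro that[of M']) auto
    qed
    have "\<forall>h\<in>insert g G. (\<forall>x\<in>M'. \<forall>y\<in>M'. h x = h y) \<or> inj_on h M'"
    proof
      fix h assume "h \<in> insert g G"
      then show "(\<forall>x\<in>M'. \<forall>y\<in>M'. h x = h y) \<or> inj_on h M'"
        using M(3) M'(1,3) inj_on_subset[of h M M'] by (metis insertE subsetD)
    qed
    moreover have "M' \<subseteq> N"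
      using M(1) M'(1) by (rule order_trans[rotated])
    ultimately show ?case
      using M'(2) by (intro exI[of _ M'] conjI)
  qed
  then show thesis
    using that by blast
qed

text \<open>Tychonoff: the selections on \<open>D\<close> form a compact product of finite discrete
  spaces, and those agreeing with \<open>f\<close> on the finite set \<open>\<kappa> f\<close> form
  an open neighbourhood of \<open>f\<close>.\<close>

lemma finite_subcover_selections:
  fixes D :: "'i set" and n :: "'i \<Rightarrow> nat" and \<kappa> :: "('i \<Rightarrow> nat) \<Rightarrow> 'i set"
  assumes fin: "\<And>f. \<forall>i\<in>D. f i < n i \<Longrightarrow> finite (\<kappa> f)"
  obtains F where "finite F" "\<And>f. f \<in> F \<Longrightarrow> \<forall>i\<in>D. f i < n i"
    "\<And>g. \<forall>i\<in>D. g i < n i \<Longrightarrow> \<exists>f\<in>F. \<forall>i\<in>D \<inter> \<kappa> f. g i = f i"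
proof -
  let ?X = "product_topology (\<lambda>i. discrete_topology {..<n i}) D"
  let ?W = "\<lambda>f. PiE D (\<lambda>i. if i \<in> \<kappa> f then {f i} else {..<n i})"
  have top: "topspace ?X = PiE D (\<lambda>i. {..<n i})"
    by simp
  have sel: "\<forall>i\<in>D. f i < n i" if "f \<in> topspace ?X" for f
    using that by (auto simp: top PiE_iff)
  have "openin ?X (?W f)" if "f \<in> topspace ?X" for f
  proof -
    have "{i \<in> D. (if i \<in> \<kappa> f then {f i} else {..<n i}) \<noteq> topspace (discrete_topology {..<n i})} \<subseteq> \<kappa> f"
      by auto
    moreover have "openin (discrete_topology {..<n i}) (if i \<in> \<kappa> f then {f i} else {..<n i})"
      if "i \<in> D" for i
      using sel[OF \<open>f \<in> topspace ?X\<close>] that by simp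
    ultimately show ?thesis
      using fin[OF sel[OF that]] unfolding openin_PiE_gen by (blast intro: finite_subset)
  qed
  moreover have "topspace ?X \<subseteq> \<Union> (?W ` topspace ?X)"
  proof
    fix f assume "f \<in> topspace ?X"
    then have "f \<in> ?W f"
      by (auto simp: top PiE_iff)
    then show "f \<in> \<Union> (?W ` topspace ?X)"
      using \<open>f \<in> topspace ?X\<close> by blast
  qed
  moreover have "compact_space ?X"
    by (simp add: compact_space_product_topology compact_space_discrete_topology)
  then have "\<forall>\<U>. (\<forall>U\<in>\<U>. openin ?X U) \<and> topspace ?X \<subseteq> \<Union> \<U> \<longrightarrow>
      (\<exists>\<F>. finite \<F> \<and> \<F> \<subseteq> \<U> \<and> topspace ?X \<subseteq> \<Union> \<F>)"
    unfolding compact_space_alt .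
  ultimately have "\<exists>\<F>. finite \<F> \<and> \<F> \<subseteq> ?W ` topspace ?X \<and> topspace ?X \<subseteq> \<Union> \<F>"
    by (elim allE[of _ "?W ` topspace ?X"] impE) auto
  then obtain F where F: "finite F" "F \<subseteq> topspace ?X" "topspace ?X \<subseteq> \<Union> (?W ` F)"
    by (elim exE conjE finite_subset_image[elim_format]) blast+
  show thesis
  proof (rule that[OF F(1)])
    show "\<forall>i\<in>D. f i < n i" if "f \<in> F" for f
      using sel F(2) that by blast
    fix g assume "\<forall>i\<in>D. g i < n i"
    \<comment> \<open>Points of the product are extensional functions, so \<open>g\<close> is cut
      down to \<open>D\<close> first.\<close>
    then have "restrict g D \<in> topspace ?X"
      by (auto simp: top)
    then obtain f where f: "f \<in> F" "restrict g D \<in> ?W f"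
      using F(3) by blast
    have "g i = f i" if "i \<in> D \<inter> \<kappa> f" for i
      using PiE_mem[OF f(2), of i] that by simp
    then show "\<exists>f\<in>F. \<forall>i\<in>D \<inter> \<kappa> f. g i = f i"
      using f(1) by blast
  qed
qed

section \<open>Well-founded models of ground programs\<close>

text \<open>The least model of the reduct of \<open>P\<close> in which the atoms of \<open>Y\<close>
  make negative literals true. Mapping \<open>S\<close> to \<open>derivable P (- S)\<close> is the
  Gelfond-Lifschitz operator, whose fixed points are the stable models.\<close>

definition derivable :: "('p, 'f, 'v) nprog \<Rightarrow> ('p, 'f, 'v) atom set \<Rightarrow> ('p, 'f, 'v) atom set" where
  "derivable P Y = lfp (\<lambda>X. {h. \<exists>ls. (h, ls) \<in> P \<and> (\<forall>l\<in>set ls. lit_true (X, Y) l)})"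

lemma lit_true_mono:
  assumes "lit_true I l" "fst I \<subseteq> fst J" "snd I \<subseteq> snd J"
  shows "lit_true J l"
  using assms by (cases l) auto

lemma mono_derivable_step:
  fixes P :: "('p, 'f, 'v) nprog"
  shows "mono (\<lambda>X. {h. \<exists>ls. (h, ls) \<in> P \<and> (\<forall>l\<in>set ls. lit_true (X, Y) l)})"
proof (rule monoI)
  fix X X' :: "('p, 'f, 'v) atom set" assume "X \<subseteq> X'"
  then have "lit_true (X, Y) l \<Longrightarrow> lit_true (X', Y) l" for l
    using lit_true_mono by fastforce
  then show "{h. \<exists>ls. (h, ls) \<in> P \<and> (\<forall>l\<in>set ls. lit_true (X, Y) l)}
    \<subseteq> {h. \<exists>ls. (h, ls) \<in> P \<and> (\<forall>l\<in>set ls. lit_true (X', Y) l)}"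
    by blast
qed

lemma derivable_iff:
  "h \<in> derivable P Y \<longleftrightarrow> (\<exists>ls. (h, ls) \<in> P \<and> (\<forall>l\<in>set ls. lit_true (derivable P Y, Y) l))"
  unfolding derivable_def by (subst lfp_unfold[OF mono_derivable_step]) blast

lemma derivable_subset:
  assumes "\<And>h ls. (h, ls) \<in> P \<Longrightarrow> h \<in> derivable P Y
    \<Longrightarrow> \<forall>l\<in>set ls. lit_true (X \<inter> derivable P Y, Y) l \<Longrightarrow> h \<in> X"
  shows "derivable P Y \<subseteq> X"
proof
  fix h assume "h \<in> derivable P Y"
  then show "h \<in> X"
    unfolding derivable_def
  proof (rule lfp_induct_set[OF _ mono_derivable_step], goal_cases)
    case (1 h)
    then obtain ls where ls: "(h, ls) \<in> P" "\<forall>l\<in>set ls. lit_true (X \<inter> derivable P Y, Y) l"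
      by (auto simp: derivable_def Int_def conj_commute)
    moreover have "\<forall>l\<in>set ls. lit_true (derivable P Y, Y) l"
      using ls(2) lit_true_mono by fastforce
    ultimately show ?case
      using assms derivable_iff by blast
  qed
qed

lemma derivable_mono:
  assumes "P \<subseteq> P'" "Y \<subseteq> Y'"
  shows "derivable P Y \<subseteq> derivable P' Y'"
proof (rule derivable_subset)
  fix h ls
  assume "(h, ls) \<in> P" "\<forall>l\<in>set ls. lit_true (derivable P' Y' \<inter> derivable P Y, Y) l"
  then have "(h, ls) \<in> P'" "\<forall>l\<in>set ls. lit_true (derivable P' Y', Y') l"
    using assms lit_true_mono by fastforce+
  then show "h \<in> derivable P' Y'"
    using derivable_iff by blast
qed

section \<open>Ground programs and the alternating fixpoint form of the construction\<close>

definition ground_prog :: "('f \<Rightarrow> nat) \<Rightarrow> ('p, 'f, 'v) nprog \<Rightarrow> bool" where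
  "ground_prog fa P \<longleftrightarrow>
    (\<forall>(h, ls)\<in>P. h \<in> gatoms fa \<and> (\<forall>l\<in>set ls. lit_atom l \<in> gatoms fa))"

lemma subst_trm_Var [simp]: "subst_trm Var t = t"
  by (induction t) (auto simp: map_idI)

lemma subst_atom_Var [simp]: "subst_atom Var a = a"
  by (cases a) (auto simp: map_idI)

lemma subst_lit_Var [simp]: "subst_lit Var l = l"
  by (cases l) auto

lemma subst_clause_Var [simp]: "subst_clause Var C = C"
  by (cases C) (auto simp: subst_clause_def map_idI)

lemma grounding_subst_empty [simp]: "grounding_subst fa {} \<theta> \<longleftrightarrow> \<theta> = Var"
  by (auto simp: grounding_subst_def)

lemma ground_prog_vars:
  assumes "ground_prog fa P" "C \<in> P"
  shows "clause_vars C = {}"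
  using assms unfolding ground_prog_def clause_vars_def gatoms_def
  by (cases C) (simp, blast)

lemma ground_prog_instance_iff:
  assumes "ground_prog fa P" "C \<in> P"
  shows "grounding_subst fa (clause_vars C) \<theta> \<longleftrightarrow> \<theta> = Var"
  by (simp add: ground_prog_vars[OF assms])

lemma TrueOp_ground:
  assumes "ground_prog fa P"
  shows "TrueOp fa P I Tr = {h. h \<notin> fst I \<and>
    (\<exists>ls. (h, ls) \<in> P \<and> (\<forall>l\<in>set ls. lit_true I l \<or> lit_true (Tr, {}) l))}"
proof -
  have "(\<exists>C\<in>P. \<exists>\<theta>. grounding_subst fa (clause_vars C) \<theta> \<and> h = subst_atom \<theta> (fst C) \<and>
        (\<forall>l\<in>set (snd C). lit_true I (subst_lit \<theta> l) \<or> lit_true (Tr, {}) (subst_lit \<theta> l)))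
    \<longleftrightarrow> (\<exists>C\<in>P. h = fst C \<and> (\<forall>l\<in>set (snd C). lit_true I l \<or> lit_true (Tr, {}) l))" for h
    by (intro bex_cong refl) (simp add: ground_prog_instance_iff[OF assms])
  then show ?thesis
    by (simp add: TrueOp_def Bex_def)
qed

lemma FalseOp_ground:
  assumes "ground_prog fa P"
  shows "FalseOp fa P I Fa = {h \<in> gatoms fa. h \<notin> snd I \<and>
    (\<forall>ls. (h, ls) \<in> P \<longrightarrow> (\<exists>l\<in>set ls. lit_false I l \<or> lit_false ({}, Fa) l))}"
proof -
  have "(\<forall>C\<in>P. \<forall>\<theta>. grounding_subst fa (clause_vars C) \<theta> \<and> h = subst_atom \<theta> (fst C) \<longrightarrow>
        (\<exists>l\<in>set (snd C). lit_false I (subst_lit \<theta> l) \<or> lit_false ({}, Fa) (subst_lit \<theta> l)))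
    \<longleftrightarrow> (\<forall>C\<in>P. h = fst C \<longrightarrow>
        (\<exists>l\<in>set (snd C). lit_false I l \<or> lit_false ({}, Fa) l))" for h
    by (intro ball_cong refl) (simp add: ground_prog_instance_iff[OF assms])
  then show ?thesis
    by (simp add: FalseOp_def Ball_def)
qed

lemma mono_TrueOp:
  fixes P :: "('p, 'f, 'v) nprog"
  shows "mono (TrueOp fa P I)"
proof (rule monoI)
  fix X X' :: "('p, 'f, 'v) atom set" assume "X \<subseteq> X'"
  then have "lit_true (X, {}) l \<Longrightarrow> lit_true (X', {}) l" for l
    using lit_true_mono by fastforce
  then show "TrueOp fa P I X \<subseteq> TrueOp fa P I X'"
    unfolding TrueOp_def by blast
qed

lemma mono_FalseOp:
  fixes P :: "('p, 'f, 'v) nprog"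
  shows "mono (FalseOp fa P I)"
proof (rule monoI)
  fix X X' :: "('p, 'f, 'v) atom set" assume "X \<subseteq> X'"
  then have "lit_false ({}, X) l \<Longrightarrow> lit_false ({}, X') l" for l
    by (cases l) auto
  then show "FalseOp fa P I X \<subseteq> FalseOp fa P I X'"
    unfolding FalseOp_def by blast
qed

text \<open>Van Gelder's alternating fixpoint operator: an atom becomes false if it is not derivable
  even when every atom not known to be true is assumed false. It agrees with \<open>wfm_step\<close>
  on the stages, and its monotonicity is immediate.\<close>

definition wf_step :: "('f \<Rightarrow> nat) \<Rightarrow> ('p, 'f, 'v) nprog \<Rightarrow> ('p, 'f, 'v) interp
    \<Rightarrow> ('p, 'f, 'v) interp" where
  "wf_step fa P I = (derivable P (snd I), gatoms fa - derivable P (- fst I))"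

lemma mono_wf_step:
  fixes P :: "('p, 'f, 'v) nprog"
  shows "mono (wf_step fa P)"
proof (rule monoI)
  fix I J :: "('p, 'f, 'v) interp" assume "I \<le> J"
  then have "derivable P (snd I) \<subseteq> derivable P (snd J)"
    "derivable P (- fst J) \<subseteq> derivable P (- fst I)"
    by (auto simp: less_eq_prod_def intro!: derivable_mono[OF order_refl])
  then show "wf_step fa P I \<le> wf_step fa P J"
    by (auto simp: wf_step_def less_eq_prod_def)
qed

text \<open>\<open>TrueOp\<close> leaves out the atoms already true in \<open>I\<close>, so its
  least fixed point alone misses them; the union restores them, and the premise on
  \<open>fst I\<close> makes them derivable as well.\<close>

lemma lfp_TrueOp_ground:
  assumes P: "ground_prog fa P" and I: "fst I \<subseteq> derivable P (snd I)"
  shows "fst I \<union> lfp (TrueOp fa P I) = derivable P (snd I)"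
proof (intro equalityI Un_least I)
  show "lfp (TrueOp fa P I) \<subseteq> derivable P (snd I)"
  proof (rule lfp_lowerbound, rule subsetI)
    fix h assume "h \<in> TrueOp fa P I (derivable P (snd I))"
    then obtain ls where ls: "(h, ls) \<in> P"
      "\<forall>l\<in>set ls. lit_true I l \<or> lit_true (derivable P (snd I), {}) l"
      unfolding TrueOp_ground[OF P] by blast
    then have "\<forall>l\<in>set ls. lit_true (derivable P (snd I), snd I) l"
      using I lit_true_mono[of I _ "(derivable P (snd I), snd I)"]
        lit_true_mono[of "(derivable P (snd I), {})" _ "(derivable P (snd I), snd I)"] by auto
    then show "h \<in> derivable P (snd I)"
      using ls(1) derivable_iff by blast
  qed
next
  let ?X = "fst I \<union> lfp (TrueOp fa P I)"
  show "derivable P (snd I) \<subseteq> ?X"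
  proof (rule derivable_subset)
    fix h ls
    assume h: "(h, ls) \<in> P" "\<forall>l\<in>set ls. lit_true (?X \<inter> derivable P (snd I), snd I) l"
    have "lit_true I l \<or> lit_true (lfp (TrueOp fa P I), {}) l" if "l \<in> set ls" for l
      using h(2) that by (cases l) force+
    then have "h \<in> fst I \<or> h \<in> TrueOp fa P I (lfp (TrueOp fa P I))"
      using h(1) unfolding TrueOp_ground[OF P] by blast
    then show "h \<in> ?X"
      using lfp_unfold[OF mono_TrueOp] by blast
  qed
qed

text \<open>Induction on derivations keeps \<open>derivable P (- fst I)\<close> disjoint from
  \<open>gfp (FalseOp fa P I)\<close>. Conversely, each clause for an underivable atom has a body
  literal that is not true, so the underivable ground atoms outside \<open>snd I\<close> form a
  post-fixed point of \<open>FalseOp\<close>.\<close>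

lemma gfp_FalseOp_ground:
  assumes P: "ground_prog fa P" and I: "snd I \<subseteq> gatoms fa - derivable P (- fst I)"
  shows "snd I \<union> gfp (FalseOp fa P I) = gatoms fa - derivable P (- fst I)"
proof (intro equalityI Un_least I)
  let ?F = "gfp (FalseOp fa P I)" and ?D = "derivable P (- fst I)"
  have F: "?F = FalseOp fa P I ?F"
    by (rule gfp_unfold[OF mono_FalseOp])
  have "?D \<subseteq> - ?F"
  proof (rule derivable_subset)
    fix h ls
    assume h: "(h, ls) \<in> P" "\<forall>l\<in>set ls. lit_true (- ?F \<inter> ?D, - fst I) l"
    have "\<not> lit_false I l \<and> \<not> lit_false ({}, ?F) l" if "l \<in> set ls" for l
      using h(2) that I by (cases l) force+
    then have "h \<notin> FalseOp fa P I ?F"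
      using h(1) unfolding FalseOp_ground[OF P] by blast
    then show "h \<in> - ?F"
      using F by blast
  qed
  moreover have "?F \<subseteq> gatoms fa"
    by (subst F) (auto simp: FalseOp_def)
  ultimately show "?F \<subseteq> gatoms fa - ?D"
    by blast
next
  let ?D = "derivable P (- fst I)"
  let ?G = "gatoms fa - ?D - snd I"
  have "?G \<subseteq> FalseOp fa P I ?G"
  proof
    fix h assume h: "h \<in> ?G"
    have "\<exists>l\<in>set ls. lit_false I l \<or> lit_false ({}, ?G) l" if ls: "(h, ls) \<in> P" for ls
    proof -
      obtain l where l: "l \<in> set ls" "\<not> lit_true (?D, - fst I) l"
        using h ls derivable_iff by blast
      moreover have "lit_atom l \<in> gatoms fa"
        using P ls l(1) unfolding ground_prog_def by fast
      ultimately have "lit_false I l \<or> lit_false ({}, ?G) l"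
        by (cases l rule: lit.exhaust) auto
      then show ?thesis
        using l(1) by blast
    qed
    then show "h \<in> FalseOp fa P I ?G"
      using h unfolding FalseOp_ground[OF P] by blast
  qed
  then have "?G \<subseteq> gfp (FalseOp fa P I)"
    by (rule gfp_upperbound)
  then show "gatoms fa - ?D \<subseteq> snd I \<union> gfp (FalseOp fa P I)"
    by blast
qed

lemma wfm_step_eq_wf_step:
  assumes "ground_prog fa P" "I \<le> wf_step fa P I"
  shows "wfm_step fa P I = wf_step fa P I"
  using assms lfp_TrueOp_ground[of fa P I] gfp_FalseOp_ground[of fa P I]
  by (auto simp: wfm_step_def wf_step_def less_eq_prod_def)

text \<open>Supplies the premise of \<open>wfm_step_eq_wf_step\<close> at every stage. At limits,
  each member of the chain is below its own step and, by monotonicity, below the step of the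
  union.\<close>

lemma wfm_stage_le_wf_step:
  assumes "wfm_stage fa P I" "ground_prog fa P"
  shows "I \<le> wf_step fa P I"
  using assms(1)
proof induction
  case zero
  then show ?case by (simp add: less_eq_prod_def)
next
  case (succ I)
  then show ?case
    using wfm_step_eq_wf_step[OF assms(2)] mono_wf_step[THEN monoD] by metis
next
  case (lim S)
  let ?U = "(\<Union> (fst ` S), \<Union> (snd ` S))"
  have "I \<le> wf_step fa P ?U" if "I \<in> S" for I
  proof -
    have "I \<le> ?U"
      using that by (auto simp: less_eq_prod_def)
    then show ?thesis
      using lim that mono_wf_step[THEN monoD] order_trans by blast
  qed
  then show ?case
    by (force simp: less_eq_prod_def)
qed

lemma wfm_step_stage:
  assumes "wfm_stage fa P I" "ground_prog fa P"
  shows "wfm_step fa P I = wf_step fa P I"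
  using assms wfm_step_eq_wf_step wfm_stage_le_wf_step by blast

text \<open>Makes a stage fixed by the step the least closed interpretation. This yields uniqueness
  of the well-founded model and, later, upper bounds for it from closed pairs.\<close>

lemma wfm_stage_le_closed:
  assumes "wfm_stage fa P I" "ground_prog fa P" "wf_step fa P J \<le> J"
  shows "I \<le> J"
  using assms(1)
proof induction
  case zero
  then show ?case by (simp add: less_eq_prod_def)
next
  case (succ I)
  then show ?case
    using wfm_step_stage[OF _ assms(2)] mono_wf_step[THEN monoD] assms(3) order_trans by metis
next
  case (lim S)
  then show ?case by (force simp: less_eq_prod_def)
qed

text \<open>The transfinite iteration is taken from the fixpoint theorem for chain-complete orders:
  all its iterates are stages, hence so is its fixed point.\<close>

lemma wfm_stage_iterates:
  assumes "I \<in> Complete_Partial_Order.iterates (wf_step fa P)" "ground_prog fa P"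
  shows "wfm_stage fa P I"
  using assms(1)
proof induction
  case (step I)
  then show ?case
    using wfm_step_stage[OF _ assms(2)] wfm_stage.succ by metis
next
  case (Sup M)
  have "interp_chain M"
    using Sup(1) unfolding interp_chain_def chain_def less_eq_prod_def by blast
  then have "wfm_stage fa P (\<Union> (fst ` M), \<Union> (snd ` M))"
    using Sup by (intro wfm_stage.lim) auto
  then show ?case
    by (simp add: Sup_prod_def)
qed

lemma WFM_ground:
  assumes P: "ground_prog fa P"
  shows wfm_stage_WFM: "wfm_stage fa P (WFM fa P)"
    and wf_step_WFM: "wf_step fa P (WFM fa P) = WFM fa P"
proof -
  let ?J = "ccpo_class.fixp (wf_step fa P)"
  have mono: "monotone (\<le>) (\<le>) (wf_step fa P)"
    using mono_wf_step by blast
  have J: "wfm_stage fa P ?J" "wf_step fa P ?J = ?J"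
    using wfm_stage_iterates[OF ccpo_class.iterates_fixp P] mono fixp_unfold[OF mono] by auto
  have "\<exists>!I. wfm_stage fa P I \<and> wfm_step fa P I = I"
  proof (rule ex1I[of _ ?J])
    show "wfm_stage fa P ?J \<and> wfm_step fa P ?J = ?J"
      using J wfm_step_stage[OF J(1) P] by simp
    fix I assume "wfm_stage fa P I \<and> wfm_step fa P I = I"
    then show "I = ?J"
      using wfm_step_stage[OF _ P] J wfm_stage_le_closed[OF _ P] by (metis order_antisym order_refl)
  qed
  then have *: "wfm_stage fa P (WFM fa P) \<and> wfm_step fa P (WFM fa P) = WFM fa P"
    unfolding WFM_def by (rule theI')
  then show "wfm_stage fa P (WFM fa P)" ..
  then show "wf_step fa P (WFM fa P) = WFM fa P"
    using * wfm_step_stage[OF _ P] by metis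
qed

lemma WFM_disjoint:
  assumes "ground_prog fa P"
  shows "fst (WFM fa P) \<inter> snd (WFM fa P) = {}"
proof -
  obtain X Y where XY: "WFM fa P = (X, Y)"
    by (cases "WFM fa P")
  then have X: "X = derivable P Y" and Y: "Y = gatoms fa - derivable P (- X)"
    using wf_step_WFM[OF assms] by (auto simp: wf_step_def)
  \<comment> \<open>\<open>?K\<close> is the dual interpretation: the possibly true atoms, and the
    atoms not certainly true. It is closed under \<open>wf_step\<close>, so \<open>WFM fa P\<close>
    lies below it, which puts the false atoms outside \<open>X\<close>.\<close>
  let ?K = "(derivable P (- X), gatoms fa - X)"
  have "X \<subseteq> derivable P (- derivable P (- X))"
    using X Y derivable_mono[OF order_refl] by (metis Diff_subset_conv Un_upper2 Diff_eq Int_lower2)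
  moreover have "derivable P (gatoms fa - X) \<subseteq> derivable P (- X)"
    by (rule derivable_mono) auto
  ultimately have "wf_step fa P ?K \<le> ?K"
    by (auto simp: wf_step_def less_eq_prod_def)
  then have "WFM fa P \<le> ?K"
    using wfm_stage_le_closed assms wfm_stage_WFM by blast
  then show ?thesis
    by (auto simp: XY less_eq_prod_def)
qed

lemma total_WFM_stable:
  assumes P: "ground_prog fa P" and total: "gatoms fa \<subseteq> fst (WFM fa P) \<union> snd (WFM fa P)"
  shows "derivable P (- fst (WFM fa P)) = fst (WFM fa P)"
proof -
  obtain X Y where XY: "WFM fa P = (X, Y)"
    by (cases "WFM fa P")
  then have X: "X = derivable P Y" and Y: "Y = gatoms fa - derivable P (- X)"
    using wf_step_WFM[OF P] by (auto simp: wf_step_def)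
  have "Y \<subseteq> - X"
    using WFM_disjoint[OF P] XY by auto
  then have "X \<subseteq> derivable P (- X)"
    using X derivable_mono[OF order_refl] by metis
  moreover have "derivable P (- X) \<subseteq> X"
    using P total XY Y derivable_iff[of _ P "- X"] unfolding ground_prog_def by force
  ultimately show ?thesis
    by (simp add: XY)
qed

text \<open>A closed pair bounds the well-founded model from above, and totality turns the bound on
  the false atoms into one on all ground atoms outside the model.\<close>

lemma total_WFM_least:
  assumes P: "ground_prog fa P" and total: "gatoms fa \<subseteq> fst (WFM fa P) \<union> snd (WFM fa P)"
    and X: "derivable P Y \<subseteq> X" and Y: "gatoms fa - derivable P (- X) \<subseteq> Y"
  shows "fst (WFM fa P) \<subseteq> X" "gatoms fa - fst (WFM fa P) \<subseteq> Y"
proof -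
  have "wf_step fa P (X, Y) \<le> (X, Y)"
    using X Y by (simp add: wf_step_def less_eq_prod_def)
  then have "WFM fa P \<le> (X, Y)"
    using wfm_stage_le_closed P wfm_stage_WFM by blast
  then show "fst (WFM fa P) \<subseteq> X" "gatoms fa - fst (WFM fa P) \<subseteq> Y"
    using total by (auto simp: less_eq_prod_def)
qed

text \<open>A stable \<open>S\<close> gives the closed pair \<open>(S, gatoms fa - S)\<close>, whose
  two bounds are the two inclusions.\<close>

lemma total_WFM_unique:
  assumes P: "ground_prog fa P" and total: "gatoms fa \<subseteq> fst (WFM fa P) \<union> snd (WFM fa P)"
    and S: "derivable P (- S) = S"
  shows "fst (WFM fa P) = S"
proof
  have "derivable P (gatoms fa - S) \<subseteq> derivable P (- S)"
    by (rule derivable_mono) auto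
  then have *: "derivable P (gatoms fa - S) \<subseteq> S"
    using S by simp
  show "fst (WFM fa P) \<subseteq> S"
    using total_WFM_least(1)[OF P total *] S by auto
  have "S \<subseteq> gatoms fa"
    using P S derivable_iff[of _ P "- S"] unfolding ground_prog_def by blast
  then show "S \<subseteq> fst (WFM fa P)"
    using total_WFM_least(2)[OF P total *] S by auto
qed

section \<open>Finite iterates and the term-size bound\<close>

lemma wfm_stage_funpow:
  assumes "ground_prog fa P"
  shows "wfm_stage fa P ((wf_step fa P ^^ k) ({}, {}))"
proof (induction k)
  case 0
  then show ?case by (simp add: wfm_stage.zero)
next
  case (Suc k)
  then show ?case
    using wfm_step_stage[OF _ assms] wfm_stage.succ by (metis funpow.simps(2) comp_apply)
qed

text \<open>A body is a finite list and the iterates increase, so the maximum of the indices needed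
  by its literals serves them all.\<close>

lemma derivable_finite_iterate:
  assumes ls: "\<forall>l\<in>set ls. lit_true (fst I \<union> (\<Union>n. (TrueOp fa P I ^^ n) {}), snd I) l"
  obtains n where "\<forall>l\<in>set ls. lit_true I l \<or> lit_true ((TrueOp fa P I ^^ n) {}, {}) l"
proof -
  let ?it = "\<lambda>n. (TrueOp fa P I ^^ n) {}"
  have mono: "?it m \<subseteq> ?it n" if "m \<le> n" for m n
    using funpow_decreasing[OF that mono_TrueOp, of fa P I] by simp
  have "\<exists>n. \<forall>l\<in>set ls. lit_true I l \<or> lit_true (?it n, {}) l"
    using ls
  proof (induction ls)
    case Nil
    then show ?case by simp
  next
    case (Cons k ls)
    then obtain n where n: "\<forall>l\<in>set ls. lit_true I l \<or> lit_true (?it n, {}) l"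
      by auto
    obtain m where m: "lit_true I k \<or> lit_true (?it m, {}) k"
      using Cons.prems by (cases k) auto
    have "lit_true (?it i, {}) l \<Longrightarrow> lit_true (?it (max m n), {}) l" if "i \<in> {m, n}" for i l
      by (erule lit_true_mono) (use that mono[of i "max m n"] in auto)
    then show ?case
      using m n by (intro exI[of _ "max m n"]) auto
  qed
  then show thesis
    using that by blast
qed

lemma derivable_subset_iterates:
  assumes P: "ground_prog fa P"
  shows "derivable P (snd I) \<subseteq> fst I \<union> (\<Union>n. (TrueOp fa P I ^^ n) {})" (is "_ \<subseteq> ?X")
proof (rule derivable_subset)
  fix h ls
  assume h: "(h, ls) \<in> P" "\<forall>l\<in>set ls. lit_true (?X \<inter> derivable P (snd I), snd I) l"
  have "\<forall>l\<in>set ls. lit_true (?X, snd I) l"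
    using h(2) lit_true_mono by fastforce
  then obtain n where "\<forall>l\<in>set ls. lit_true I l \<or> lit_true ((TrueOp fa P I ^^ n) {}, {}) l"
    by (rule derivable_finite_iterate)
  then have "h \<in> fst I \<or> h \<in> (TrueOp fa P I ^^ Suc n) {}"
    using h(1) by (auto simp: TrueOp_ground[OF P])
  then show "h \<in> ?X"
    by blast
qed

text \<open>Frees the term-size bound from the iterates: a body true with respect to
  \<open>derivable P (snd I)\<close> is already true at some finite iterate.\<close>

lemma bounded_term_size_ground:
  assumes P: "ground_prog fa P" and "bounded_term_size fa P"
  obtains L where "\<And>I h ls. wfm_stage fa P I \<Longrightarrow> (h, ls) \<in> P \<Longrightarrow> h \<notin> fst I
    \<Longrightarrow> \<forall>l\<in>set ls. lit_true (derivable P (snd I), snd I) l \<Longrightarrow> clause_size (h, ls) \<le> L"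
proof -
  obtain L where L: "\<And>I n C \<theta>. wfm_stage fa P I \<Longrightarrow> C \<in> P \<Longrightarrow>
      grounding_subst fa (clause_vars C) \<theta> \<and> subst_atom \<theta> (fst C) \<notin> fst I \<and>
      (\<forall>l\<in>set (snd C). lit_true I (subst_lit \<theta> l) \<or>
                         lit_true ((TrueOp fa P I ^^ n) {}, {}) (subst_lit \<theta> l)) \<Longrightarrow>
      clause_size (subst_clause \<theta> C) \<le> L"
    using assms(2) unfolding bounded_term_size_def by blast
  have "clause_size (h, ls) \<le> L"
    if "wfm_stage fa P I" "(h, ls) \<in> P" "h \<notin> fst I"
      "\<forall>l\<in>set ls. lit_true (derivable P (snd I), snd I) l" for I h ls
  proof -
    have "\<forall>l\<in>set ls. lit_true (fst I \<union> (\<Union>n. (TrueOp fa P I ^^ n) {}), snd I) l"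
      using that(4) lit_true_mono derivable_subset_iterates[OF P, of I] by fastforce
    then obtain n where "\<forall>l\<in>set ls. lit_true I l \<or> lit_true ((TrueOp fa P I ^^ n) {}, {}) l"
      by (rule derivable_finite_iterate)
    then show ?thesis
      using L[OF that(1,2), of Var n] that(3) ground_prog_instance_iff[OF P that(2)] by simp
  qed
  then show thesis
    using that by blast
qed

text \<open>An atom that is new at a successor stage is the head of a clause that fires there; all
  other atoms come from earlier stages.\<close>

lemma wfm_stage_true_subset:
  assumes P: "ground_prog fa P"
    and B: "\<And>I h ls. wfm_stage fa P I \<Longrightarrow> (h, ls) \<in> P \<Longrightarrow> h \<notin> fst I
      \<Longrightarrow> \<forall>l\<in>set ls. lit_true (derivable P (snd I), snd I) l \<Longrightarrow> h \<in> B"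
    and "wfm_stage fa P I"
  shows "fst I \<subseteq> B"
  using assms(3)
proof induction
  case zero
  then show ?case by simp
next
  case (succ I)
  have "fst (wfm_step fa P I) = derivable P (snd I)"
    by (simp add: wfm_step_stage[OF succ.hyps P] wf_step_def)
  then show ?case
    using B[OF succ.hyps] succ.IH derivable_iff[of _ P "snd I"] by blast
next
  case (lim S)
  then show ?case by auto
qed

section \<open>Selections and their stable models\<close>

text \<open>Abstracts from substitutions: \<open>D\<close> indexes the ground instances and
  \<open>cl\<close> names the clause of an instance. Selections become functions from indices to
  head positions, so changing choices is function update and compactness applies to them.\<close>

locale ground_lpad =
  fixes fa :: "'f \<Rightarrow> nat" and D :: "'i set"
    and hds :: "'i \<Rightarrow> ('p, 'f, 'v) atom list" and body :: "'i \<Rightarrow> ('p, 'f, 'v) lit list"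
    and cl :: "'i \<Rightarrow> 'c"
  assumes finite_cl: "finite (cl ` D)"
    and length_hds: "\<And>i j. i \<in> D \<Longrightarrow> j \<in> D \<Longrightarrow> cl i = cl j \<Longrightarrow> length (hds i) = length (hds j)"
    and length_body: "\<And>i j. i \<in> D \<Longrightarrow> j \<in> D \<Longrightarrow> cl i = cl j \<Longrightarrow> length (body i) = length (body j)"
    and inst_inj: "\<And>i j. i \<in> D \<Longrightarrow> j \<in> D \<Longrightarrow> cl i = cl j \<Longrightarrow> hds i = hds j
      \<Longrightarrow> body i = body j \<Longrightarrow> i = j"
    and gatoms_hds: "\<And>i. i \<in> D \<Longrightarrow> set (hds i) \<subseteq> gatoms fa"
    and gatoms_body: "\<And>i. i \<in> D \<Longrightarrow> lit_atom ` set (body i) \<subseteq> gatoms fa"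
begin

definition sel :: "('i \<Rightarrow> nat) \<Rightarrow> bool" where
  "sel f \<longleftrightarrow> (\<forall>i\<in>D. f i < length (hds i))"

definition inst :: "('i \<Rightarrow> nat) \<Rightarrow> 'i \<Rightarrow> ('p, 'f, 'v) nclause" where
  "inst f i = (hds i ! f i, body i)"

definition prog :: "('i \<Rightarrow> nat) \<Rightarrow> ('p, 'f, 'v) nprog" where
  "prog f = inst f ` D"

definition M :: "('i \<Rightarrow> nat) \<Rightarrow> ('p, 'f, 'v) atom set" where
  "M f = fst (WFM fa (prog f))"

definition rel :: "('p, 'f, 'v) atom set \<Rightarrow> 'i set" where
  "rel S = {i \<in> D. \<forall>l\<in>set (body i). lit_true (S, - S) l}"

lemma ground_prog_prog:
  assumes "sel f"
  shows "ground_prog fa (prog f)"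
proof -
  have "hds i ! f i \<in> gatoms fa" if "i \<in> D" for i
    using assms gatoms_hds[OF that] that unfolding sel_def by (metis nth_mem subsetD)
  then show ?thesis
    using gatoms_body by (auto simp: ground_prog_def prog_def inst_def)
qed

lemma derivable_progI:
  assumes "i \<in> D" "\<forall>l\<in>set (body i). lit_true (derivable (prog f) Y, Y) l"
  shows "hds i ! f i \<in> derivable (prog f) Y"
  using assms derivable_iff[of _ "prog f" Y] by (auto simp: prog_def inst_def)

lemma derivable_prog_subset:
  assumes "\<And>i. i \<in> D \<Longrightarrow> \<forall>l\<in>set (body i). lit_true (X \<inter> derivable (prog f) Y, Y) l
    \<Longrightarrow> hds i ! f i \<in> X"
  shows "derivable (prog f) Y \<subseteq> X"
  by (rule derivable_subset) (use assms in \<open>auto simp: prog_def inst_def\<close>)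

text \<open>Each derivation uses finitely many instances: the supports of the body literals are
  united with the instance itself.\<close>

lemma finite_support:
  assumes "a \<in> derivable (prog f) Y"
  shows "\<exists>E\<subseteq>D. finite E \<and> a \<in> derivable (inst f ` E) Y"
proof -
  let ?X = "{a. \<exists>E\<subseteq>D. finite E \<and> a \<in> derivable (inst f ` E) Y}"
  have "derivable (prog f) Y \<subseteq> ?X"
  proof (rule derivable_prog_subset)
    fix i assume i: "i \<in> D" "\<forall>l\<in>set (body i). lit_true (?X \<inter> derivable (prog f) Y, Y) l"
    have "\<exists>E\<subseteq>D. finite E \<and> lit_true (derivable (inst f ` E) Y, Y) l" if "l \<in> set (body i)" for l
      using i(2) that by (cases l rule: lit.exhaust) force+
    then obtain E where E: "\<And>l. l \<in> set (body i) \<Longrightarrow> E l \<subseteq> D \<and> finite (E l)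
        \<and> lit_true (derivable (inst f ` E l) Y, Y) l"
      by metis
    let ?E = "insert i (\<Union>l\<in>set (body i). E l)"
    have "lit_true (derivable (inst f ` ?E) Y, Y) l" if "l \<in> set (body i)" for l
    proof -
      have "derivable (inst f ` E l) Y \<subseteq> derivable (inst f ` ?E) Y"
        by (rule derivable_mono) (use that in auto)
      then show ?thesis
        using E[OF that] lit_true_mono by fastforce
    qed
    then have "hds i ! f i \<in> derivable (inst f ` ?E) Y"
      using derivable_iff[of "hds i ! f i" "inst f ` ?E" Y] by (auto simp: inst_def)
    moreover have "?E \<subseteq> D" "finite ?E"
      using i(1) E by auto
    ultimately show "hds i ! f i \<in> ?X"
      by blast
  qed
  then show ?thesis
    using assms by blast
qed

end

text \<open>The term-size bound enters as a finite set \<open>B\<close> of atoms that holds the head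
  and the body of every instance firing at a stage where its head is not yet true.\<close>

locale sound_bounded_lpad = ground_lpad +
  assumes total: "\<And>f. sel f \<Longrightarrow> gatoms fa \<subseteq> fst (WFM fa (prog f)) \<union> snd (WFM fa (prog f))"
    and bounded: "\<And>f. sel f \<Longrightarrow> \<exists>B. finite B \<and> (\<forall>I i. wfm_stage fa (prog f) I \<longrightarrow> i \<in> D
      \<longrightarrow> hds i ! f i \<notin> fst I
      \<longrightarrow> (\<forall>l\<in>set (body i). lit_true (derivable (prog f) (snd I), snd I) l)
      \<longrightarrow> hds i ! f i \<in> B \<and> lit_atom ` set (body i) \<subseteq> B)"
begin

lemma M_stable: "sel f \<Longrightarrow> derivable (prog f) (- M f) = M f"
  unfolding M_def by (intro total_WFM_stable ground_prog_prog total)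

lemma M_least:
  assumes "sel f" "derivable (prog f) Y \<subseteq> X" "gatoms fa - derivable (prog f) (- X) \<subseteq> Y"
  shows "M f \<subseteq> X"
  unfolding M_def using assms total_WFM_least ground_prog_prog total by metis

lemma M_unique:
  assumes "sel f" "derivable (prog f) (- S) = S"
  shows "M f = S"
  unfolding M_def using assms total_WFM_unique ground_prog_prog total by metis

lemma head_in_M:
  assumes "sel f" "i \<in> rel (M f)"
  shows "hds i ! f i \<in> M f"
  using assms M_stable[OF assms(1)] derivable_progI[of i f "- M f"] by (auto simp: rel_def)

lemma finite_M:
  assumes "sel f"
  shows "finite (M f)"
proof -
  obtain B where B: "finite B" "\<And>I i. wfm_stage fa (prog f) I \<Longrightarrow> i \<in> D
      \<Longrightarrow> hds i ! f i \<notin> fst I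
      \<Longrightarrow> \<forall>l\<in>set (body i). lit_true (derivable (prog f) (snd I), snd I) l
      \<Longrightarrow> hds i ! f i \<in> B"
    using bounded[OF assms] by metis
  have "M f \<subseteq> B"
    unfolding M_def
  proof (rule wfm_stage_true_subset[OF ground_prog_prog[OF assms]])
    show "wfm_stage fa (prog f) (WFM fa (prog f))"
      using wfm_stage_WFM ground_prog_prog assms by blast
  qed (use B(2) in \<open>auto simp: prog_def inst_def\<close>)
  then show ?thesis
    using B(1) finite_subset by blast
qed

text \<open>\<open>M f\<close> is shown to be stable for \<open>g\<close>. Only instances in
  \<open>rel (M f)\<close> can fire, and their new heads stay in \<open>M f\<close>; the instances
  of \<open>E\<close> that fire keep their heads, so every derivation of \<open>M f\<close> from
  \<open>E\<close> is preserved.\<close>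

lemma M_cong_rel:
  assumes f: "sel f" and g: "sel g"
    and rel: "\<And>i. i \<in> rel (M f) \<Longrightarrow> hds i ! g i = hds i ! f i \<or> hds i ! g i \<in> M f \<and> i \<notin> E"
    and E: "E \<subseteq> D" "M f \<subseteq> derivable (inst f ` E) (- M f)"
  shows "M g = M f"
proof (rule M_unique[OF g], rule equalityI)
  show "derivable (prog g) (- M f) \<subseteq> M f"
  proof (rule derivable_prog_subset)
    fix i
    assume i: "i \<in> D" "\<forall>l\<in>set (body i). lit_true (M f \<inter> derivable (prog g) (- M f), - M f) l"
    then have "i \<in> rel (M f)"
      using lit_true_mono by (fastforce simp: rel_def)
    then show "hds i ! g i \<in> M f"
      using rel[of i] head_in_M[OF f, of i] by auto
  qed
next
  have "derivable (inst f ` E) (- M f) \<subseteq> derivable (prog f) (- M f)"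
    using E(1) by (intro derivable_mono) (auto simp: prog_def)
  then have M_eq: "derivable (inst f ` E) (- M f) = M f"
    using E(2) M_stable[OF f] by auto
  have "derivable (inst f ` E) (- M f) \<subseteq> derivable (prog g) (- M f)"
  proof (rule derivable_subset, unfold M_eq)
    fix h ls
    assume h: "(h, ls) \<in> inst f ` E"
      and ls: "\<forall>l\<in>set ls. lit_true (derivable (prog g) (- M f) \<inter> M f, - M f) l"
    then obtain i where i: "i \<in> E" "h = hds i ! f i" "ls = body i"
      by (auto simp: inst_def)
    have "i \<in> rel (M f)"
      using i ls E(1) lit_true_mono by (fastforce simp: rel_def)
    then have "hds i ! g i = h"
      using rel i by auto
    moreover have "hds i ! g i \<in> derivable (prog g) (- M f)"
      using ls lit_true_mono i E(1) by (intro derivable_progI) fastforce+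
    ultimately show "h \<in> derivable (prog g) (- M f)"
      by simp
  qed
  then show "M f \<subseteq> derivable (prog g) (- M f)"
    using M_eq by simp
qed

lemma M_eq_if_agree_on_rel:
  assumes "sel f" "sel g" "\<And>i. i \<in> rel (M f) \<Longrightarrow> g i = f i"
  shows "M g = M f"
  by (rule M_cong_rel[where E = D])
    (use assms M_stable[OF assms(1)] in \<open>auto simp: prog_def\<close>)

end

section \<open>Relevant instances with a head outside the model\<close>

text \<open>The configuration to be refuted: infinitely many relevant instances with the same chosen
  position \<open>z\<close> and a head at position \<open>c\<close> outside \<open>M f\<close>, made
  homogeneous so that every position is constant or injective on \<open>N\<close>. Body positions
  that vary carry negative literals only.\<close>

locale relevant_family = sound_bounded_lpad +
  fixes f :: "'b \<Rightarrow> nat" and N :: "'b set" and r m c z :: nat and n0 :: 'b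
  assumes sel_f: "sel f" and infinite_N: "infinite N" and N_rel: "N \<subseteq> rel (M f)"
    and n0: "n0 \<in> N"
    and len_hds: "\<And>n. n \<in> N \<Longrightarrow> length (hds n) = r"
    and len_body: "\<And>n. n \<in> N \<Longrightarrow> length (body n) = m"
    and f_N: "\<And>n. n \<in> N \<Longrightarrow> f n = z"
    and c: "c < r" and head_c: "\<And>n. n \<in> N \<Longrightarrow> hds n ! c \<notin> M f"
    and hds_const_or_inj: "\<And>k. k < r \<Longrightarrow>
      (\<forall>n\<in>N. hds n ! k = hds n0 ! k) \<or> inj_on (\<lambda>n. hds n ! k) N"
    and body_const_or_inj: "\<And>k. k < m \<Longrightarrow>
      (\<forall>n\<in>N. body n ! k = body n0 ! k) \<or>
      inj_on (\<lambda>n. body n ! k) N \<and> (\<forall>n\<in>N. \<exists>a. body n ! k = Neg a)"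
    and hds_body_inj: "inj_on (\<lambda>n. (hds n, body n)) N"
begin

lemma N_D: "N \<subseteq> D"
  using N_rel by (auto simp: rel_def)

lemma z: "z < r"
  using sel_f f_N[OF n0] len_hds[OF n0] n0 N_D unfolding sel_def by auto

text \<open>Some instance of \<open>N\<close> is relevant for \<open>g\<close>, and it settles the
  constant body positions for all of \<open>N\<close>. At a varying position the literals are
  distinct and negative, and the finite set \<open>M g\<close> falsifies only finitely many of
  them.\<close>

lemma finite_irrelevant:
  assumes g: "sel g" and agree: "\<And>i. i \<in> D - N \<Longrightarrow> g i = f i"
  shows "finite (N - rel (M g))"
proof -
  have "N \<inter> rel (M g) \<noteq> {}"
  proof
    assume *: "N \<inter> rel (M g) = {}"
    \<comment> \<open>If no instance of \<open>N\<close> were relevant for \<open>g\<close>, then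
      \<open>f\<close> and \<open>g\<close> would agree on \<open>rel (M g)\<close> and have the
      same model, although \<open>N\<close> is relevant for \<open>f\<close>.\<close>
    have "M f = M g"
      by (rule M_eq_if_agree_on_rel[OF g sel_f])
        (use * agree in \<open>force simp: rel_def\<close>)
    then show False
      using * N_rel n0 by auto
  qed
  then obtain n1 where n1: "n1 \<in> N" "n1 \<in> rel (M g)"
    by auto
  let ?bad = "\<lambda>k. {n \<in> N. \<not> lit_true (M g, - M g) (body n ! k)}"
  have "finite (?bad k)" if k: "k < m" for k
    using body_const_or_inj[OF k]
  proof
    assume const: "\<forall>n\<in>N. body n ! k = body n0 ! k"
    have "lit_true (M g, - M g) (body n1 ! k)"
      using n1 len_body k nth_mem[of k "body n1"] by (auto simp: rel_def)
    then have "?bad k = {}"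
      using const n1(1) by auto
    then show ?thesis
      by (metis finite.emptyI)
  next
    assume inj: "inj_on (\<lambda>n. body n ! k) N \<and> (\<forall>n\<in>N. \<exists>a. body n ! k = Neg a)"
    have "?bad k \<subseteq> (\<lambda>n. body n ! k) -` (Neg ` M g) \<inter> N"
      using inj by force
    moreover have "finite \<dots>"
      using inj finite_M[OF g] by (intro finite_vimage_IntI) auto
    ultimately show ?thesis
      by (rule finite_subset)
  qed
  moreover have "N - rel (M g) \<subseteq> (\<Union>k<m. ?bad k)"
  proof
    fix n assume n: "n \<in> N - rel (M g)"
    then obtain l where "l \<in> set (body n)" "\<not> lit_true (M g, - M g) l"
      using N_D by (auto simp: rel_def)
    then show "n \<in> (\<Union>k<m. ?bad k)"
      using n len_body by (auto simp: in_set_conv_nth)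
  qed
  ultimately show ?thesis
    using finite_subset by blast
qed

section \<open>Flipping choices within the family\<close>

definition flip :: "nat \<Rightarrow> 'b set \<Rightarrow> 'b \<Rightarrow> nat" where
  "flip p N1 i = (if i \<in> N1 then p else f i)"

lemma sel_flip: "p < r \<Longrightarrow> N1 \<subseteq> N \<Longrightarrow> sel (flip p N1)"
  using sel_f len_hds by (auto simp: sel_def flip_def)

lemma infinite_chosen_head:
  assumes g: "sel g" "\<And>i. i \<in> D - N \<Longrightarrow> g i = f i"
    and N1: "infinite N1" "N1 \<subseteq> N" "\<And>n. n \<in> N1 \<Longrightarrow> g n = p"
  shows "infinite {n \<in> N1. hds n ! p \<in> M g}"
proof -
  have "N1 \<inter> rel (M g) \<subseteq> {n \<in> N1. hds n ! p \<in> M g}"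
    using head_in_M[OF g(1)] N1(3) by force
  moreover have "infinite (N1 \<inter> rel (M g))"
  proof
    assume "finite (N1 \<inter> rel (M g))"
    moreover have "N1 \<subseteq> (N1 \<inter> rel (M g)) \<union> (N - rel (M g))"
      using N1(2) by blast
    ultimately show False
      using finite_irrelevant[OF g] N1(1) by (meson finite_UnI finite_subset)
  qed
  ultimately show ?thesis
    using finite_subset by blast
qed

text \<open>If position \<open>p\<close> were injective on \<open>N\<close>, choosing it throughout
  \<open>N\<close> would put infinitely many distinct heads into a finite model.\<close>

lemma hds_const:
  assumes p: "p < r" and n: "n \<in> N"
  shows "hds n ! p = hds n0 ! p"
proof (rule ccontr)
  assume "hds n ! p \<noteq> hds n0 ! p"
  then have inj: "inj_on (\<lambda>n. hds n ! p) N"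
    using hds_const_or_inj[OF p] n by blast
  let ?g = "flip p N"
  have sel: "sel ?g"
    by (rule sel_flip[OF p order_refl])
  have "infinite {n \<in> N. hds n ! p \<in> M ?g}"
    by (rule infinite_chosen_head[OF sel _ infinite_N order_refl]) (auto simp: flip_def)
  moreover have "finite ((\<lambda>n. hds n ! p) -` M ?g \<inter> N)"
    by (rule finite_vimage_IntI[OF finite_M[OF sel] inj])
  moreover have "{n \<in> N. hds n ! p \<in> M ?g} = (\<lambda>n. hds n ! p) -` M ?g \<inter> N"
    by blast
  ultimately show False
    by simp
qed

text \<open>All heads being constant by \<open>hds_const\<close>, distinct instances can differ only
  in their bodies.\<close>

lemma body_inj_position:
  obtains k where "k < m" "inj_on (\<lambda>n. body n ! k) N"
proof -
  have "\<exists>k<m. inj_on (\<lambda>n. body n ! k) N"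
  proof (rule ccontr)
    assume "\<not> ?thesis"
    then have "body n ! k = body n0 ! k" if "n \<in> N" "k < m" for n k
      using body_const_or_inj that by blast
    then have "hds n = hds n0 \<and> body n = body n0" if "n \<in> N" for n
      using that n0 hds_const len_hds len_body by (metis nth_equalityI)
    then have "N \<subseteq> {n0}"
      using inj_onD[OF hds_body_inj _ _ n0] by auto
    then show False
      using infinite_N finite_subset by blast
  qed
  then show thesis
    using that by blast
qed

abbreviation Hc where "Hc \<equiv> hds n0 ! c"
abbreviation Hz where "Hz \<equiv> hds n0 ! z"

lemma flip_heads:
  assumes "N1 \<subseteq> N"
  shows flip_Hc: "infinite N1 \<Longrightarrow> Hc \<in> M (flip c N1)"
    and flip_Hz: "infinite (N - N1) \<Longrightarrow> Hz \<in> M (flip c N1)"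
proof -
  let ?g = "flip c N1"
  have g: "sel ?g" "\<And>i. i \<in> D - N \<Longrightarrow> ?g i = f i"
    using sel_flip c assms by (auto simp: flip_def)
  show "Hc \<in> M ?g" if "infinite N1"
  proof -
    have "{n \<in> N1. hds n ! c \<in> M ?g} \<noteq> {}"
      using infinite_chosen_head[OF g that assms, of c]
      by (metis (no_types, lifting) finite.emptyI flip_def)
    then show ?thesis
      using hds_const[OF c] assms by auto
  qed
  show "Hz \<in> M ?g" if "infinite (N - N1)"
  proof -
    have "?g n = z" if "n \<in> N - N1" for n
      using that f_N by (simp add: flip_def)
    then have "{n \<in> N - N1. hds n ! z \<in> M ?g} \<noteq> {}"
      using infinite_chosen_head[OF g \<open>infinite (N - N1)\<close>, of z]
      by (metis (no_types, lifting) Diff_subset finite.emptyI)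
    then show ?thesis
      using hds_const[OF z] by auto
  qed
qed

text \<open>The stages \<open>J k\<close> follow the construction of the well-founded model of \<open>prog f\<close>, except that
  \<open>Hc\<close> counts as supported whenever atoms are declared false. This is what remains valid in a world
  where infinitely many instances of the family are flipped to \<open>Hc\<close>.\<close>
definition prog_plus :: "('c, 'a, 'd) nprog" where
  "prog_plus = insert (Hc, []) (prog f)"

definition step_plus :: "('c, 'a, 'd) interp \<Rightarrow> ('c, 'a, 'd) interp" where
  "step_plus I = (derivable (prog f) (snd I), gatoms fa - derivable prog_plus (- fst I))"

definition J :: "nat \<Rightarrow> ('c, 'a, 'd) interp" where
  "J k = (step_plus ^^ k) ({}, {})"

lemma J_0 [simp]: "J 0 = ({}, {})"
  by (simp add: J_def)

lemma J_Suc: "J (Suc k) = step_plus (J k)"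
  by (simp add: J_def)

lemma fst_J_Suc: "fst (J (Suc k)) = derivable (prog f) (snd (J k))"
  and snd_J_Suc: "snd (J (Suc k)) = gatoms fa - derivable prog_plus (- fst (J k))"
  by (simp_all add: J_Suc step_plus_def)

lemma mono_step_plus: "mono step_plus"
proof (rule monoI)
  fix I I' :: "('c, 'a, 'd) interp" assume "I \<le> I'"
  then have "derivable (prog f) (snd I) \<subseteq> derivable (prog f) (snd I')"
    "derivable prog_plus (- fst I') \<subseteq> derivable prog_plus (- fst I)"
    by (auto simp: less_eq_prod_def intro!: derivable_mono[OF order_refl])
  then show "step_plus I \<le> step_plus I'"
    by (auto simp: step_plus_def less_eq_prod_def)
qed

lemma J_mono: "j \<le> k \<Longrightarrow> J j \<le> J k"
proof (rule lift_Suc_mono_le[of J])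
  show "J n \<le> J (Suc n)" for n
  proof (induction n)
    case 0
    then show ?case by (simp add: less_eq_prod_def)
  next
    case (Suc n)
    then show ?case
      unfolding J_Suc using mono_step_plus[THEN monoD] by (metis J_Suc)
  qed
qed

text \<open>The premises make \<open>(S, - S)\<close> closed under \<open>step_plus\<close>. This is
  used both for \<open>M f\<close> and for the models of flipped selections.\<close>

lemma J_le:
  assumes "derivable (prog f) (- S) \<subseteq> S" "S \<subseteq> derivable prog_plus (- S)"
  shows "J k \<le> (S, - S)"
proof (induction k)
  case 0
  then show ?case by (simp add: less_eq_prod_def)
next
  case (Suc k)
  have "step_plus (S, - S) \<le> (S, - S)"
    using assms by (auto simp: step_plus_def less_eq_prod_def)
  then show ?case
    unfolding J_Suc using Suc mono_step_plus[THEN monoD] order_trans by blast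
qed

lemma J_le_M: "J k \<le> (M f, - M f)"
proof (rule J_le)
  have "derivable (prog f) (- M f) \<subseteq> derivable prog_plus (- M f)"
    by (rule derivable_mono) (auto simp: prog_plus_def)
  then show "M f \<subseteq> derivable prog_plus (- M f)"
    by (simp add: M_stable[OF sel_f])
qed (simp add: M_stable[OF sel_f])

text \<open>The true atoms increase within the finite set \<open>M f\<close>. The false atoms depend
  only on the true atoms one stage earlier, so they become constant one step later.\<close>

lemma J_stabilizes: "\<exists>K. J (Suc K) = J K"
proof -
  have fst_sub: "fst (J k) \<subseteq> M f" for k
    using J_le_M[of k] by (simp add: less_eq_prod_def)
  have "finite (range (\<lambda>k. fst (J k)))"
  proof (rule finite_subset)
    show "range (\<lambda>k. fst (J k)) \<subseteq> Pow (M f)"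
      using fst_sub by (intro image_subsetI PowI)
  qed (simp add: finite_M[OF sel_f])
  then have "\<exists>k0\<in>UNIV. infinite {k\<in>UNIV. fst (J k) = fst (J k0)}"
    by (intro pigeonhole_infinite infinite_UNIV_nat)
  then obtain k0 where k0: "infinite {k. fst (J k) = fst (J k0)}"
    by auto
  have const: "fst (J k) = fst (J k0)" if "k0 \<le> k" for k
  proof -
    obtain k' where "k \<le> k'" "fst (J k') = fst (J k0)"
      using infinite_nat_iff_unbounded_le[THEN iffD1, rule_format, OF k0, of k] by blast
    then show ?thesis
      using J_mono[OF that] J_mono[of k k'] unfolding less_eq_prod_def by blast
  qed
  have "J (Suc (Suc k0)) = J (Suc k0)"
  proof (rule prod_eqI)
    show "fst (J (Suc (Suc k0))) = fst (J (Suc k0))"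
      using const[of "Suc k0"] const[of "Suc (Suc k0)"] by simp
    show "snd (J (Suc (Suc k0))) = snd (J (Suc k0))"
      using const[of "Suc k0"] by (simp add: snd_J_Suc)
  qed
  then show ?thesis ..
qed

lemma derivable_flip_subset:
  assumes "N1 \<subseteq> N"
  shows "derivable (prog (flip c N1)) Y \<subseteq> derivable prog_plus Y"
proof (rule derivable_prog_subset)
  fix i
  assume i: "i \<in> D" and "\<forall>l\<in>set (body i).
    lit_true (derivable prog_plus Y \<inter> derivable (prog (flip c N1)) Y, Y) l"
  then have l: "\<forall>l\<in>set (body i). lit_true (derivable prog_plus Y, Y) l"
    using lit_true_mono by fastforce
  show "hds i ! flip c N1 i \<in> derivable prog_plus Y"
  proof (cases "i \<in> N1")
    case True
    then have "hds i ! flip c N1 i = Hc"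
      using hds_const[OF c] assms by (auto simp: flip_def)
    then show ?thesis
      using derivable_iff[of Hc prog_plus Y] by (auto simp: prog_plus_def)
  next
    case False
    then have "(hds i ! flip c N1 i, body i) \<in> prog_plus"
      using i by (auto simp: prog_plus_def prog_def inst_def flip_def)
    then show ?thesis
      using l derivable_iff by blast
  qed
qed

lemma derivable_f_subset_flip:
  assumes N1: "N1 \<subseteq> N" and Hz: "Hz \<in> derivable (prog (flip c N1)) Y"
  shows "derivable (prog f) Y \<subseteq> derivable (prog (flip c N1)) Y"
proof (rule derivable_prog_subset)
  fix i
  assume i: "i \<in> D" and "\<forall>l\<in>set (body i).
    lit_true (derivable (prog (flip c N1)) Y \<inter> derivable (prog f) Y, Y) l"
  then have l: "\<forall>l\<in>set (body i). lit_true (derivable (prog (flip c N1)) Y, Y) l"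
    using lit_true_mono by fastforce
  show "hds i ! f i \<in> derivable (prog (flip c N1)) Y"
  proof (cases "i \<in> N1")
    case True
    then have "hds i ! f i = Hz"
      using hds_const[OF z] N1 f_N by auto
    then show ?thesis
      using Hz by simp
  next
    case False
    then show ?thesis
      using derivable_progI[OF i l] by (simp add: flip_def)
  qed
qed

text \<open>With both \<open>N1\<close> and \<open>N - N1\<close> infinite, \<open>Hc\<close> and
  \<open>Hz\<close> lie in \<open>M (flip c N1)\<close> and so are derivable from
  \<open>- X\<close>. The extra fact \<open>Hc\<close> then adds nothing, and the flipped instances
  lose nothing, because their old head was \<open>Hz\<close>.\<close>

lemma derivable_plus_eq_flip:
  assumes N1: "N1 \<subseteq> N" "infinite N1" "infinite (N - N1)" and X: "X \<subseteq> M (flip c N1)"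
  shows "derivable (prog (flip c N1)) (- X) = derivable prog_plus (- X)" (is "?G = ?P")
proof (rule equalityI[OF derivable_flip_subset[OF N1(1)]])
  have sel: "sel (flip c N1)"
    using sel_flip c N1(1) by blast
  have "derivable (prog (flip c N1)) (- M (flip c N1)) \<subseteq> ?G"
    by (rule derivable_mono) (use X in auto)
  then have M_sub: "M (flip c N1) \<subseteq> ?G"
    using M_stable[OF sel] by simp
  then have "derivable (prog f) (- X) \<subseteq> ?G"
    using derivable_f_subset_flip flip_Hz N1 by blast
  show "?P \<subseteq> ?G"
  proof (rule derivable_subset)
    fix h ls
    assume h: "(h, ls) \<in> prog_plus" and l: "\<forall>l\<in>set ls. lit_true (?G \<inter> ?P, - X) l"
    have "\<forall>l\<in>set ls. lit_true (?G, - X) l"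
      using l lit_true_mono by fastforce
    then show "h \<in> ?G"
    proof (cases "h = Hc")
      case True
      then show ?thesis
        using flip_Hc[OF N1(1,2)] M_sub by auto
    next
      case False
      then obtain i where i: "i \<in> D" "h = hds i ! f i" "ls = body i"
        using h by (auto simp: prog_plus_def prog_def inst_def)
      show ?thesis
      proof (cases "i \<in> N1")
        case True
        then have "h = Hz"
          using i hds_const[OF z] N1 f_N by auto
        then show ?thesis
          using flip_Hz[OF N1(1,3)] M_sub by auto
      next
        case False
        have "hds i ! flip c N1 i \<in> ?G"
          using \<open>\<forall>l\<in>set ls. lit_true (?G, - X) l\<close> i by (intro derivable_progI) auto
        then show ?thesis
          using i False by (simp add: flip_def)
      qed
    qed
  qed
qed

lemma J_le_flip:
  assumes N1: "N1 \<subseteq> N" "infinite N1" "infinite (N - N1)"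
  shows "J k \<le> (M (flip c N1), - M (flip c N1))"
proof (rule J_le)
  have sel: "sel (flip c N1)"
    using sel_flip c N1(1) by blast
  show "derivable (prog f) (- M (flip c N1)) \<subseteq> M (flip c N1)"
    using derivable_f_subset_flip[OF N1(1), of "- M (flip c N1)"] flip_Hz[OF N1(1,3)]
    by (simp add: M_stable[OF sel])
  show "M (flip c N1) \<subseteq> derivable prog_plus (- M (flip c N1))"
    using derivable_flip_subset[OF N1(1), of "- M (flip c N1)"] by (simp add: M_stable[OF sel])
qed

text \<open>Some \<open>Q k\<close> is infinite: if \<open>Q K\<close> were finite once \<open>J\<close> is stable at \<open>K\<close>, flipping infinitely many
  instances outside \<open>Q K\<close> would leave the true atoms within \<open>M f\<close>, which does not contain \<open>Hc\<close>.\<close>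
definition Q :: "nat \<Rightarrow> 'b set" where
  "Q k = {n \<in> N. \<forall>l\<in>set (body n). lit_true (derivable (prog f) (snd (J k)), snd (J k)) l}"

lemma infinite_Q: "\<exists>k. infinite (Q k)"
proof -
  obtain K where K: "J (Suc K) = J K"
    using J_stabilizes by blast
  then have fst_K: "fst (J K) = derivable (prog f) (snd (J K))"
    and snd_K: "snd (J K) = gatoms fa - derivable prog_plus (- fst (J K))"
    using fst_J_Suc[of K] snd_J_Suc[of K] by simp_all
  have "infinite (Q K)"
  proof
    assume "finite (Q K)"
    then have "infinite (N - Q K)"
      using infinite_N by simp
    \<comment> \<open>The second half \<open>N2\<close> stays unflipped, which makes
      \<open>N - N1\<close> infinite and keeps \<open>Hz\<close> true.\<close>
    then obtain N1 N2 where N12: "N1 \<subseteq> N - Q K" "N2 \<subseteq> N - Q K" "infinite N1" "infinite N2"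
      "N1 \<inter> N2 = {}"
      by (rule infinite_split)
    have N1: "N1 \<subseteq> N" "infinite N1" "infinite (N - N1)"
      using N12 infinite_super[of N2 "N - N1"] by auto
    let ?g = "flip c N1"
    have sel: "sel ?g"
      using sel_flip c N1(1) by blast
    \<comment> \<open>\<open>J K\<close> is a closed pair for the flipped program, since no instance
      of \<open>N1\<close> fires at it.\<close>
    have "M ?g \<subseteq> fst (J K)"
    proof (rule M_least[OF sel])
      show "derivable (prog ?g) (snd (J K)) \<subseteq> fst (J K)"
      proof (rule derivable_prog_subset)
        fix i
        assume i: "i \<in> D" and "\<forall>l\<in>set (body i).
          lit_true (fst (J K) \<inter> derivable (prog ?g) (snd (J K)), snd (J K)) l"
        then have l: "\<forall>l\<in>set (body i). lit_true (derivable (prog f) (snd (J K)), snd (J K)) l"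
          unfolding fst_K using lit_true_mono by fastforce
        then have "i \<notin> N1"
          using N12(1) by (auto simp: Q_def)
        then show "hds i ! ?g i \<in> fst (J K)"
          using derivable_progI[OF i l] fst_K by (simp add: flip_def)
      qed
      have "fst (J K) \<subseteq> M ?g"
        using J_le_flip[OF N1, of K] by (simp add: less_eq_prod_def)
      then show "gatoms fa - derivable (prog ?g) (- fst (J K)) \<subseteq> snd (J K)"
        using derivable_plus_eq_flip[OF N1] snd_K by simp
    qed
    then show False
      using flip_Hc[OF N1(1,2)] J_le_M[of K] head_c[OF n0] by (auto simp: less_eq_prod_def)
  qed
  then show ?thesis ..
qed

text \<open>The body of a flipped instance is not true at stage \<open>j\<close>, so its choice of
  head does not matter there.\<close>

lemma derivable_flip_eq:
  assumes N1: "N1 \<subseteq> N" "N1 \<inter> Q j = {}"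
  shows "derivable (prog (flip c N1)) (snd (J j)) = derivable (prog f) (snd (J j))" (is "?G = ?F")
proof
  have *: "hds i ! flip c N1 i = hds i ! f i"
    if "\<forall>l\<in>set (body i). lit_true (?F, snd (J j)) l" for i
    using that N1 by (auto simp: Q_def flip_def)
  show "?G \<subseteq> ?F"
  proof (rule derivable_prog_subset)
    fix i assume i: "i \<in> D" and "\<forall>l\<in>set (body i). lit_true (?F \<inter> ?G, snd (J j)) l"
    then have l: "\<forall>l\<in>set (body i). lit_true (?F, snd (J j)) l"
      using lit_true_mono by fastforce
    then show "hds i ! flip c N1 i \<in> ?F"
      using * derivable_progI[OF i l] by simp
  qed
  show "?F \<subseteq> ?G"
  proof (rule derivable_prog_subset)
    fix i assume i: "i \<in> D" and "\<forall>l\<in>set (body i). lit_true (?G \<inter> ?F, snd (J j)) l"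
    then have l: "\<forall>l\<in>set (body i). lit_true (?F, snd (J j)) l"
      "\<forall>l\<in>set (body i). lit_true (?G, snd (J j)) l"
      using lit_true_mono by fastforce+
    then show "hds i ! f i \<in> ?G"
      using *[OF l(1)] derivable_progI[OF i l(2)] by simp
  qed
qed

text \<open>Take the first \<open>k\<close> with \<open>Q k\<close> infinite and flip half of the
  instances that are new in \<open>Q k\<close>. Up to \<open>k\<close> the flipped program runs
  through the same \<open>J j\<close>, so \<open>J k\<close> is one of its stages. There all flipped
  instances fire with the new head \<open>Hc\<close>, and the term-size bound confines their bodies
  to finitely many atoms, against an injective body position.\<close>

lemma contradiction: False
proof -
  define k where "k = (LEAST k. infinite (Q k))"
  have Qk: "infinite (Q k)"
    unfolding k_def using infinite_Q by (rule LeastI_ex)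
  have "finite (Q j)" if "j < k" for j
    using that not_less_Least unfolding k_def by blast
  then have "infinite (Q k - (\<Union>j<k. Q j))"
    using Qk by (simp add: Diff_infinite_finite)
  then obtain N1 N2 where N12: "N1 \<subseteq> Q k - (\<Union>j<k. Q j)" "N2 \<subseteq> Q k - (\<Union>j<k. Q j)"
    "infinite N1" "infinite N2" "N1 \<inter> N2 = {}"
    by (rule infinite_split)
  have Q_N: "Q k \<subseteq> N"
    by (auto simp: Q_def)
  have N1: "N1 \<subseteq> N" "infinite N1" "infinite (N - N1)"
    using N12 Q_N infinite_super[of N2 "N - N1"] by blast+
  let ?g = "flip c N1" and ?Y = "snd (J k)"
  have sel: "sel ?g"
    using sel_flip c N1(1) by blast
  have "(wf_step fa (prog ?g) ^^ j) ({}, {}) = J j" if "j \<le> k" for j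
    using that
  proof (induction j)
    case 0
    then show ?case by simp
  next
    case (Suc j)
    have "N1 \<inter> Q j = {}"
      using N12(1) Suc.prems by auto
    then have "derivable (prog ?g) (snd (J j)) = derivable (prog f) (snd (J j))"
      by (rule derivable_flip_eq[OF N1(1)])
    moreover have "derivable (prog ?g) (- fst (J j)) = derivable prog_plus (- fst (J j))"
      using J_le_flip[OF N1, of j] by (intro derivable_plus_eq_flip N1) (simp add: less_eq_prod_def)
    ultimately have "wf_step fa (prog ?g) (J j) = J (Suc j)"
      by (simp add: wf_step_def J_Suc step_plus_def)
    then show ?case
      using Suc by simp
  qed
  then have stage: "wfm_stage fa (prog ?g) (J k)"
    using wfm_stage_funpow[OF ground_prog_prog[OF sel]] by (metis order_refl)
  \<comment> \<open>An unflipped instance of \<open>Q k\<close>, which takes over the derivation of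
    \<open>Hz\<close> from the flipped ones.\<close>
  obtain n2 where n2: "n2 \<in> N2"
    using N12(4) by (metis finite.emptyI ex_in_conv)
  have n2': "n2 \<in> D" "n2 \<in> N" "n2 \<in> Q k" "n2 \<notin> N1"
    using n2 N12 Q_N N_D by auto
  have sub: "derivable (prog f) ?Y \<subseteq> derivable (prog ?g) ?Y" (is "?F \<subseteq> ?G")
  proof (rule derivable_prog_subset)
    fix i assume i: "i \<in> D" and l: "\<forall>l\<in>set (body i). lit_true (?G \<inter> ?F, ?Y) l"
    then have l: "\<forall>l\<in>set (body i). lit_true (?G, ?Y) l"
      using lit_true_mono by fastforce
    show "hds i ! f i \<in> ?G"
    proof (cases "i \<in> N1")
      case True
      then have iN: "i \<in> N"
        using N1(1) by blast
      \<comment> \<open>At constant positions \<open>n2\<close> shares the literals of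
        \<open>i\<close>, which are true already; at the others its literals are negative and depend
        on \<open>?Y\<close> only.\<close>
      have "lit_true (?G, ?Y) (body n2 ! q)" if q: "q < m" for q
        using body_const_or_inj[OF q]
      proof
        assume "\<forall>n\<in>N. body n ! q = body n0 ! q"
        then have "body n2 ! q = body i ! q"
          using iN n2' by simp
        then show ?thesis
          using l len_body[OF iN] q by (metis nth_mem)
      next
        assume "inj_on (\<lambda>n. body n ! q) N \<and> (\<forall>n\<in>N. \<exists>a. body n ! q = Neg a)"
        then obtain a where a: "body n2 ! q = Neg a"
          using n2' by blast
        have "lit_true (?F, ?Y) (body n2 ! q)"
          using n2' q len_body[of n2] by (auto simp: Q_def)
        then show ?thesis
          by (simp add: a)
      qed
      then have "hds n2 ! ?g n2 \<in> ?G"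
        using n2' len_body[of n2] by (intro derivable_progI) (auto simp: in_set_conv_nth)
      then have "Hz \<in> ?G"
        using n2' f_N hds_const[OF z] by (simp add: flip_def)
      then show ?thesis
        using hds_const[OF z] iN f_N by simp
    next
      case False
      then show ?thesis
        using derivable_progI[OF i l] by (simp add: flip_def)
    qed
  qed
  obtain B where B: "finite B" "\<And>I i. wfm_stage fa (prog ?g) I \<Longrightarrow> i \<in> D
      \<Longrightarrow> hds i ! ?g i \<notin> fst I
      \<Longrightarrow> \<forall>l\<in>set (body i). lit_true (derivable (prog ?g) (snd I), snd I) l
      \<Longrightarrow> lit_atom ` set (body i) \<subseteq> B"
    using bounded[OF sel] by metis
  obtain q where q: "q < m" "inj_on (\<lambda>n. body n ! q) N"
    by (rule body_inj_position)
  have "body n ! q \<in> Pos ` B \<union> Neg ` B" if n: "n \<in> N1" for n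
  proof -
    have nN: "n \<in> N" "n \<in> D" "n \<in> Q k"
      using n N1(1) N_D N12(1) by auto
    have "hds n ! ?g n = Hc"
      using n nN hds_const[OF c] by (simp add: flip_def)
    moreover have "Hc \<notin> fst (J k)"
      using J_le_M[of k] head_c[OF n0] by (auto simp: less_eq_prod_def)
    moreover have "\<forall>l\<in>set (body n). lit_true (?G, ?Y) l"
      using nN(3) sub lit_true_mono by (fastforce simp: Q_def)
    ultimately have "lit_atom ` set (body n) \<subseteq> B"
      using B(2)[OF stage nN(2)] by simp
    then have "lit_atom (body n ! q) \<in> B"
      using q(1) len_body[OF nN(1)] by auto
    then show ?thesis
      by (cases "body n ! q") auto
  qed
  then have "(\<lambda>n. body n ! q) ` N1 \<subseteq> Pos ` B \<union> Neg ` B"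
    by blast
  then have "finite ((\<lambda>n. body n ! q) ` N1)"
    using B(1) by (meson finite_UnI finite_imageI finite_subset)
  then show False
    using N1 q(2) by (metis finite_imageD inj_on_subset)
qed

end

section \<open>Finitely many choices determine the model\<close>

context sound_bounded_lpad
begin

text \<open>An infinite set of such instances is thinned to a \<open>relevant_family\<close>: first
  one clause, then one chosen position and one position outside \<open>M f\<close>, then constancy
  or injectivity at each position, and finally removal of finitely many exceptions.\<close>

lemma finite_relevant_with_open_head:
  assumes f: "sel f"
  shows "finite {i \<in> rel (M f). \<not> set (hds i) \<subseteq> M f}" (is "finite ?R")
proof (rule ccontr)
  assume inf: "infinite ?R"
  have R_D: "?R \<subseteq> D"
    by (auto simp: rel_def)
  have "finite (cl ` ?R)"
    using finite_cl R_D by (meson finite_subset image_mono)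
  then obtain i0 where i0: "i0 \<in> ?R" and "infinite {i \<in> ?R. cl i = cl i0}"
    using pigeonhole_infinite[OF inf] by blast
  then obtain N0 where N0: "N0 = {i \<in> ?R. cl i = cl i0}" "infinite N0"
    by blast
  let ?r = "length (hds i0)" and ?m = "length (body i0)"
  have len: "length (hds i) = ?r" "length (body i) = ?m" if "i \<in> N0" for i
    using that i0 R_D length_hds[of i i0] length_body[of i i0] by (auto simp: N0(1))
  have "\<exists>p\<in>{..<?r} \<times> {..<?r}. f i = fst p \<and> hds i ! snd p \<notin> M f" if i: "i \<in> N0" for i
  proof -
    have iR: "i \<in> D" "\<not> set (hds i) \<subseteq> M f"
      using i R_D by (auto simp: N0(1))
    then obtain k where "k < ?r" "hds i ! k \<notin> M f"
      using len(1)[OF i] by (metis in_set_conv_nth subsetI)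
    moreover have "f i < ?r"
      using f len(1)[OF i] iR(1) by (auto simp: sel_def)
    ultimately show ?thesis
      by (intro bexI[of _ "(f i, k)"]) auto
  qed
  then obtain p where p: "p \<in> {..<?r} \<times> {..<?r}"
    "infinite {i \<in> N0. f i = fst p \<and> hds i ! snd p \<notin> M f}"
    using pigeonhole_infinite_rel[OF N0(2), of "{..<?r} \<times> {..<?r}"
        "\<lambda>i p. f i = fst p \<and> hds i ! snd p \<notin> M f"] by auto
  \<comment> \<open>\<open>Pos\<close> serves to give the head functions and the body functions a
    common type.\<close>
  let ?G = "(\<lambda>k i. Pos (hds i ! k)) ` {..<?r} \<union> (\<lambda>k i. body i ! k) ` {..<?m}"
  obtain N1 where N1: "N1 \<subseteq> {i \<in> N0. f i = fst p \<and> hds i ! snd p \<notin> M f}" "infinite N1"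
    "\<And>g. g \<in> ?G \<Longrightarrow> (\<forall>x\<in>N1. \<forall>y\<in>N1. g x = g y) \<or> inj_on g N1"
    by (rule infinite_subset_const_or_inj_on[of ?G, OF _ p(2)]) auto
  let ?I = "{k \<in> {..<?m}. inj_on (\<lambda>i. body i ! k) N1}"
  \<comment> \<open>Instances with a true positive literal at an injective position: finitely many,
    as \<open>M f\<close> is finite. Once they are removed, every varying body literal is
    negative.\<close>
  let ?X = "\<Union>k\<in>?I. (\<lambda>i. body i ! k) -` (Pos ` M f) \<inter> N1"
  have "finite ?X"
    using finite_M[OF f] by (intro finite_UN_I finite_vimage_IntI) auto
  define N where "N = N1 - ?X"
  have N: "infinite N" "N \<subseteq> N1"
    using N1(2) \<open>finite ?X\<close> by (auto simp: N_def Diff_infinite_finite)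
  then obtain n0 where n0: "n0 \<in> N"
    by (metis finite.emptyI ex_in_conv)
  have N_sub: "N \<subseteq> N0" "N \<subseteq> rel (M f)" "N \<subseteq> D"
    using N(2) N1(1) R_D by (auto simp: N0(1))
  have "relevant_family fa D hds body cl f N ?r ?m (snd p) (fst p) n0"
  proof unfold_locales
    show "sel f" "infinite N" "N \<subseteq> rel (M f)" "n0 \<in> N" "snd p < ?r"
      using f N N_sub n0 p(1) by auto
    show "length (hds n) = ?r" "length (body n) = ?m" if "n \<in> N" for n
      using len N_sub(1) that by auto
    show "f n = fst p" "hds n ! snd p \<notin> M f" if "n \<in> N" for n
      using that N(2) N1(1) by auto
    show "(\<forall>n\<in>N. hds n ! k = hds n0 ! k) \<or> inj_on (\<lambda>n. hds n ! k) N" if "k < ?r" for k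
    proof -
      have "(\<lambda>i. Pos (hds i ! k)) \<in> ?G"
        using that by blast
      from N1(3)[OF this] show ?thesis
        using n0 N(2) by (auto simp: inj_on_def)
    qed
    show "(\<forall>n\<in>N. body n ! k = body n0 ! k) \<or>
      inj_on (\<lambda>n. body n ! k) N \<and> (\<forall>n\<in>N. \<exists>a. body n ! k = Neg a)" if k: "k < ?m" for k
    proof -
      have "(\<lambda>i. body i ! k) \<in> ?G"
        using k by blast
      from N1(3)[OF this] show ?thesis
      proof
        assume "\<forall>x\<in>N1. \<forall>y\<in>N1. body x ! k = body y ! k"
        then show ?thesis
          using n0 N(2) by blast
      next
        assume inj: "inj_on (\<lambda>i. body i ! k) N1"
        have "\<exists>a. body n ! k = Neg a" if n: "n \<in> N" for n
        proof (cases "body n ! k")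
          case (Pos a)
          have "body n ! k \<in> set (body n)"
            using n k len(2)[of n] N_sub(1) by auto
          then have "lit_true (M f, - M f) (body n ! k)"
            using n N_sub(2) unfolding rel_def by blast
          then have "n \<in> ?X"
            using Pos inj k n N(2) by auto
          then show ?thesis
            using n by (simp add: N_def)
        qed auto
        then show ?thesis
          using inj_on_subset[OF inj N(2)] by blast
      qed
    qed
    show "inj_on (\<lambda>n. (hds n, body n)) N"
    proof (rule inj_onI)
      fix i j assume ij: "i \<in> N" "j \<in> N" "(hds i, body i) = (hds j, body j)"
      then have "i \<in> N0" "j \<in> N0"
        using N_sub(1) by auto
      then show "i = j"
        using ij inst_inj[of i j] N_sub(3) by (auto simp: N0(1))
    qed
  qed
  then show False
    by (rule relevant_family.contradiction)
qed

text \<open>\<open>\<kappa>\<close> unites finite supports of all atoms of \<open>M f\<close> with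
  the relevant instances that have a head outside \<open>M f\<close>. At any other relevant instance
  every choice yields a head in \<open>M f\<close>, as \<open>M_cong_rel\<close> demands.\<close>

lemma finite_determining_choice:
  assumes f: "sel f"
  obtains \<kappa> where "\<kappa> \<subseteq> D" "finite \<kappa>"
    "\<And>g. sel g \<Longrightarrow> \<forall>i\<in>\<kappa>. g i = f i \<Longrightarrow> M g = M f"
proof -
  have "\<forall>a\<in>M f. \<exists>E\<subseteq>D. finite E \<and> a \<in> derivable (inst f ` E) (- M f)"
    using finite_support M_stable[OF f] by metis
  then obtain S where S: "\<And>a. a \<in> M f \<Longrightarrow>
      S a \<subseteq> D \<and> finite (S a) \<and> a \<in> derivable (inst f ` S a) (- M f)"
    by metis
  define E where "E = (\<Union>a\<in>M f. S a)"
  have E: "E \<subseteq> D" "finite E"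
    using S finite_M[OF f] by (auto simp: E_def)
  have supp: "M f \<subseteq> derivable (inst f ` E) (- M f)"
  proof
    fix a assume a: "a \<in> M f"
    have "derivable (inst f ` S a) (- M f) \<subseteq> derivable (inst f ` E) (- M f)"
      by (rule derivable_mono) (use a in \<open>auto simp: E_def\<close>)
    then show "a \<in> derivable (inst f ` E) (- M f)"
      using S[OF a] by blast
  qed
  let ?R = "{i \<in> rel (M f). \<not> set (hds i) \<subseteq> M f}"
  show thesis
  proof (rule that[of "?R \<union> E"])
    show "?R \<union> E \<subseteq> D"
      using E(1) by (auto simp: rel_def)
    show "finite (?R \<union> E)"
      using E(2) finite_relevant_with_open_head[OF f] by simp
    fix g assume g: "sel g" and agree: "\<forall>i\<in>?R \<union> E. g i = f i"
    show "M g = M f"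
    proof (rule M_cong_rel[OF f g _ E(1) supp])
      fix i assume i: "i \<in> rel (M f)"
      have "hds i ! g i \<in> set (hds i)"
        using g i by (auto simp: sel_def rel_def)
      then show "hds i ! g i = hds i ! f i \<or> hds i ! g i \<in> M f \<and> i \<notin> E"
        using agree i by (cases "i \<in> ?R \<union> E") auto
    qed
  qed
qed

lemma finite_determining_family:
  obtains F \<kappa> where "finite F" "\<And>f. f \<in> F \<Longrightarrow> sel f" "\<And>f. f \<in> F \<Longrightarrow> \<kappa> f \<subseteq> D \<and> finite (\<kappa> f)"
    "\<And>f g. f \<in> F \<Longrightarrow> sel g \<Longrightarrow> \<forall>i\<in>\<kappa> f. g i = f i \<Longrightarrow> M g = M f"
    "\<And>g. sel g \<Longrightarrow> \<exists>f\<in>F. \<forall>i\<in>\<kappa> f. g i = f i"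
proof -
  have "\<forall>f. sel f \<longrightarrow> (\<exists>\<kappa>. \<kappa> \<subseteq> D \<and> finite \<kappa> \<and>
      (\<forall>g. sel g \<longrightarrow> (\<forall>i\<in>\<kappa>. g i = f i) \<longrightarrow> M g = M f))"
    by (metis finite_determining_choice)
  then obtain \<kappa> where \<kappa>: "\<And>f. sel f \<Longrightarrow> \<kappa> f \<subseteq> D" "\<And>f. sel f \<Longrightarrow> finite (\<kappa> f)"
    "\<And>f g. sel f \<Longrightarrow> sel g \<Longrightarrow> \<forall>i\<in>\<kappa> f. g i = f i \<Longrightarrow> M g = M f"
    by metis
  obtain F where F: "finite F" "\<And>f. f \<in> F \<Longrightarrow> sel f"
    "\<And>g. sel g \<Longrightarrow> \<exists>f\<in>F. \<forall>i\<in>D \<inter> \<kappa> f. g i = f i"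
    by (rule finite_subcover_selections[of D "\<lambda>i. length (hds i)" \<kappa>, folded sel_def])
      (use \<kappa>(2) in blast)+
  show thesis
  proof (rule that[OF F(1,2)])
    show "\<kappa> f \<subseteq> D \<and> finite (\<kappa> f)" if "f \<in> F" for f
      using \<kappa>(1,2) F(2)[OF that] by simp
    show "M g = M f" if "f \<in> F" "sel g" "\<forall>i\<in>\<kappa> f. g i = f i" for f g
      by (rule \<kappa>(3)[OF F(2)[OF that(1)] that(2,3)])
    show "\<exists>f\<in>F. \<forall>i\<in>\<kappa> f. g i = f i" if g: "sel g" for g
    proof -
      obtain f where "f \<in> F" "\<forall>i\<in>D \<inter> \<kappa> f. g i = f i"
        using F(3)[OF g] by blast
      then show ?thesis
        using \<kappa>(1)[OF F(2)] by blast
    qed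
  qed
qed

end

section \<open>Ground instances of an LPAD\<close>

lemma subst_trm_HU:
  assumes "wf_trm fa t" "\<And>x. x \<in> vars_trm t \<Longrightarrow> \<theta> x \<in> HU fa"
  shows "subst_trm \<theta> t \<in> HU fa"
  using assms by (induction t) (auto simp: HU_def)

lemma subst_atom_gatoms:
  assumes "wf_atom fa a" "\<And>x. x \<in> vars_atom a \<Longrightarrow> \<theta> x \<in> HU fa"
  shows "subst_atom \<theta> a \<in> gatoms fa"
proof (cases a)
  case (Atom p ts)
  have "subst_trm \<theta> t \<in> HU fa" if "t \<in> set ts" for t
    using assms that by (intro subst_trm_HU) (auto simp: Atom wf_atom_def vars_atom_def)
  then show ?thesis
    by (auto simp: Atom gatoms_def vars_atom_def wf_atom_def HU_def)
qed (simp add: gatoms_def vars_atom_def wf_atom_def)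

lemma subst_trm_eqD:
  assumes "subst_trm \<theta> t = subst_trm \<eta> t" "x \<in> vars_trm t"
  shows "\<theta> x = \<eta> x"
  using assms by (induction t) auto

lemma subst_atom_eqD:
  assumes "subst_atom \<theta> a = subst_atom \<eta> a" "x \<in> vars_atom a"
  shows "\<theta> x = \<eta> x"
  using assms subst_trm_eqD by (cases a) (fastforce simp: vars_atom_def)+

section \<open>Finitely many ground instances of bounded term size\<close>

lemma tsize_pos: "0 < tsize t"
  by (cases t) auto

lemma finite_ground_terms:
  "finite {t :: ('f::finite, 'v) trm. vars_trm t = {} \<and> tsize t \<le> L}" (is "finite (?G L)")
proof (induction L)
  case 0
  have "?G 0 = {}"
    using tsize_pos by (metis (no_types, lifting) Collect_empty_eq leD)
  then show ?case
    by (metis finite.emptyI)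
next
  case (Suc L)
  \<comment> \<open>Every argument has positive size, so the size of a term bounds the number of its
    arguments, and each argument is smaller than the term.\<close>
  have "?G (Suc L) \<subseteq> (\<Union>f. Fn f ` {ts. set ts \<subseteq> ?G L \<and> length ts \<le> L})"
  proof
    fix t :: "('f, 'v) trm" assume t: "t \<in> ?G (Suc L)"
    then obtain f ts where Fn: "t = Fn f ts"
      by (cases t) auto
    have "length ts \<le> sum_list (map tsize ts)"
    proof (induction ts)
      case (Cons t ts)
      then show ?case
        using tsize_pos[of t] by simp
    qed simp
    moreover have "tsize s \<le> sum_list (map tsize ts)" if "s \<in> set ts" for s
      using that by (intro member_le_sum_list) auto
    ultimately have "ts \<in> {ts. set ts \<subseteq> ?G L \<and> length ts \<le> L}"
      using t by (fastforce simp: Fn)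
    then show "t \<in> (\<Union>f. Fn f ` {ts. set ts \<subseteq> ?G L \<and> length ts \<le> L})"
      using Fn by blast
  qed
  moreover have "finite \<dots>"
    using Suc finite_lists_length_le by (intro finite_UN_I finite_imageI) auto
  ultimately show ?case
    by (rule finite_subset)
qed

text \<open>The pattern \<open>b\<close> fixes the predicate symbol and the number of arguments, so
  finiteness of the set of function symbols suffices even if the type of predicate symbols is
  infinite.\<close>

lemma finite_bounded_instances:
  fixes b :: "('p, 'f::finite, 'v) atom"
  shows "finite {a. (\<exists>\<theta>. a = subst_atom \<theta> b) \<and> a \<in> gatoms fa
    \<and> (\<forall>t\<in>set (atom_terms a). tsize t \<le> L)}" (is "finite ?A")
proof (cases b)
  case (Atom p us)
  let ?G = "{t :: ('f, 'v) trm. vars_trm t = {} \<and> tsize t \<le> L}"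
  have "?A \<subseteq> Atom p ` {ts. set ts \<subseteq> ?G \<and> length ts = length us}"
    by (auto simp: Atom gatoms_def vars_atom_def image_iff)
  then show ?thesis
    by (rule finite_subset) (intro finite_imageI finite_lists_length_eq finite_ground_terms)
next
  case Null
  have "?A \<subseteq> {Null}"
    by (auto simp: Null)
  then show ?thesis
    using finite_subset by blast
qed

lemma tsize_le_clause_size:
  assumes "a = fst C \<or> a \<in> lit_atom ` set (snd C)" "t \<in> set (atom_terms a)"
  shows "tsize t \<le> clause_size C"
  unfolding clause_size_def by (rule Max_ge) (use assms in auto)

section \<open>Translation of an LPAD into indexed ground instances\<close>

type_synonym ('p, 'f, 'v) lpad_inst = "('p, 'f, 'v) lpad_clause \<times> ('v \<Rightarrow> ('f, 'v) trm)"

definition lpad_insts :: "('f \<Rightarrow> nat) \<Rightarrow> ('p, 'f, 'v) lpad \<Rightarrow> ('p, 'f, 'v) lpad_inst set" where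
  "lpad_insts fa T = {(C, \<theta>). C \<in> T \<and> grounding_subst fa (lpad_vars C) \<theta>}"

definition inst_heads :: "('p, 'f, 'v) lpad_inst \<Rightarrow> ('p, 'f, 'v) atom list" where
  "inst_heads i = map (subst_atom (snd i)) (lpad_heads (fst i))"

definition inst_body :: "('p, 'f, 'v) lpad_inst \<Rightarrow> ('p, 'f, 'v) lit list" where
  "inst_body i = map (subst_lit (snd i)) (snd (fst i))"

definition choices :: "(('p, 'f, 'v) lpad_inst \<Rightarrow> nat) \<Rightarrow> ('p, 'f, 'v) lpad_inst set
    \<Rightarrow> (('p, 'f, 'v) lpad_clause \<times> ('v \<Rightarrow> ('f, 'v) trm) \<times> nat) set" where
  "choices f E = (\<lambda>i. (fst i, snd i, f i)) ` E"

lemma set_lpad_heads: "set (lpad_heads C) \<subseteq> insert Null (lpad_atoms C)"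
  by (auto simp: lpad_heads_def lpad_atoms_def)

lemma lit_atom_subst_lit [simp]: "lit_atom (subst_lit \<theta> l) = subst_atom \<theta> (lit_atom l)"
  by (cases l) auto

lemma lpad_inst_subst_gatoms:
  assumes T: "wf_lpad fa T" and i: "(C, \<theta>) \<in> lpad_insts fa T"
    and a: "a \<in> insert Null (lpad_atoms C)"
  shows "subst_atom \<theta> a \<in> gatoms fa"
proof (cases "a = Null")
  case True
  then show ?thesis
    by (simp add: gatoms_def vars_atom_def wf_atom_def)
next
  case False
  then have "a \<in> lpad_atoms C"
    using a by blast
  moreover have "C \<in> T"
    using i by (simp add: lpad_insts_def)
  ultimately have "wf_atom fa a" "vars_atom a \<subseteq> lpad_vars C"
    using T by (auto simp: wf_lpad_def lpad_vars_def)
  then show ?thesis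
    using i by (intro subst_atom_gatoms) (auto simp: lpad_insts_def grounding_subst_def)
qed

lemma ground_lpad_insts:
  assumes T: "wf_lpad fa T"
  shows "ground_lpad fa (lpad_insts fa T) inst_heads inst_body fst"
proof
  have "fst ` lpad_insts fa T \<subseteq> T"
    by (auto simp: lpad_insts_def)
  then show "finite (fst ` lpad_insts fa T)"
    using T finite_subset unfolding wf_lpad_def by blast
next
  fix i j :: "('b, 'a, 'c) lpad_inst"
  assume ij: "i \<in> lpad_insts fa T" "j \<in> lpad_insts fa T" "fst i = fst j"
    "inst_heads i = inst_heads j" "inst_body i = inst_body j"
  obtain C \<theta> \<eta> where i: "i = (C, \<theta>)" and j: "j = (C, \<eta>)"
    using ij(3) by (metis prod.collapse)
  have "\<theta> x = \<eta> x" if x: "x \<in> lpad_vars C" for x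
  proof -
    obtain a where a: "a \<in> lpad_atoms C" "x \<in> vars_atom a"
      using x by (auto simp: lpad_vars_def)
    have "subst_atom \<theta> a = subst_atom \<eta> a"
    proof (cases "a \<in> fst ` set (fst C)")
      case True
      then have "a \<in> set (lpad_heads C)"
        by (auto simp: lpad_heads_def)
      then show ?thesis
        using ij(4) by (auto simp: i j inst_heads_def)
    next
      case False
      then obtain l where "l \<in> set (snd C)" "a = lit_atom l"
        using a(1) by (auto simp: lpad_atoms_def)
      moreover have "subst_lit \<theta> l = subst_lit \<eta> l"
        using ij(5) calculation by (auto simp: i j inst_body_def)
      ultimately show ?thesis
        by (metis lit_atom_subst_lit)
    qed
    then show ?thesis
      using a(2) subst_atom_eqD by metis
  qed
  \<comment> \<open>Outside the clause variables both substitutions are the identity.\<close>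
  then have "\<theta> x = \<eta> x" for x
    using ij(1,2) by (cases "x \<in> lpad_vars C") (auto simp: i j lpad_insts_def grounding_subst_def)
  then show "i = j"
    by (auto simp: i j)
next
  fix i assume i: "i \<in> lpad_insts fa T"
  obtain C \<theta> where C: "i = (C, \<theta>)"
    by (cases i)
  have *: "subst_atom \<theta> a \<in> gatoms fa" if "a \<in> insert Null (lpad_atoms C)" for a
    using lpad_inst_subst_gatoms[OF T] i that C by blast
  show "set (inst_heads i) \<subseteq> gatoms fa"
    using set_lpad_heads[of C] * by (auto simp: C inst_heads_def)
  show "lit_atom ` set (inst_body i) \<subseteq> gatoms fa"
    using * by (auto simp: C inst_body_def lpad_atoms_def)
qed (auto simp: inst_heads_def inst_body_def)

lemma composite_choice_choices:
  assumes "E \<subseteq> lpad_insts fa T" "\<And>i. i \<in> E \<Longrightarrow> f i < length (inst_heads i)"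
  shows "composite_choice fa T (choices f E)"
  using assms by (fastforce simp: composite_choice_def atomic_choice_def choices_def
      lpad_insts_def inst_heads_def)

text \<open>Consistency and totality make a selection the graph of a function on the
  instances.\<close>

lemma selection_choices:
  assumes T: "wf_lpad fa T"
  defines "D \<equiv> lpad_insts fa T"
  shows "selection fa T \<sigma> \<longleftrightarrow> (\<exists>f. (\<forall>i\<in>D. f i < length (inst_heads i)) \<and> \<sigma> = choices f D)"
    (is "?L \<longleftrightarrow> ?R")
proof
  assume ?L
  then have ex: "\<exists>k. (fst i, snd i, k) \<in> \<sigma>" if "i \<in> D" for i
    using that unfolding selection_def D_def lpad_insts_def by auto
  have at: "\<And>c. c \<in> \<sigma> \<Longrightarrow> atomic_choice fa T c"
    and uniq: "\<And>C \<theta> i j. (C, \<theta>, i) \<in> \<sigma> \<Longrightarrow> (C, \<theta>, j) \<in> \<sigma> \<Longrightarrow> i = j"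
    using \<open>?L\<close> unfolding selection_def composite_choice_def by blast+
  define f where "f i = (SOME k. (fst i, snd i, k) \<in> \<sigma>)" for i
  have f: "(fst i, snd i, f i) \<in> \<sigma>" if "i \<in> D" for i
    unfolding f_def using ex[OF that] by (rule someI_ex)
  have "f i < length (inst_heads i)" if "i \<in> D" for i
    using at[OF f[OF that]] by (simp add: atomic_choice_def inst_heads_def)
  moreover have "\<sigma> = choices f D"
  proof
    show "choices f D \<subseteq> \<sigma>"
      using f by (auto simp: choices_def)
    show "\<sigma> \<subseteq> choices f D"
    proof
      fix c assume c: "c \<in> \<sigma>"
      obtain C \<theta> k where c_eq: "c = (C, \<theta>, k)"
        by (cases c)
      have D: "(C, \<theta>) \<in> D"
        using at[OF c] by (simp add: c_eq atomic_choice_def D_def lpad_insts_def)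
      have "k = f (C, \<theta>)"
        using uniq c f[OF D] by (simp add: c_eq)
      then show "c \<in> choices f D"
        using D by (force simp: choices_def c_eq)
    qed
  qed
  ultimately show ?R
    by blast
next
  assume ?R
  then obtain f where f: "\<forall>i\<in>D. f i < length (inst_heads i)" "\<sigma> = choices f D"
    by blast
  have "composite_choice fa T \<sigma>"
    using f composite_choice_choices[of D fa T f] by (simp add: D_def)
  moreover have "(C, \<theta>, f (C, \<theta>)) \<in> \<sigma>" if "C \<in> T" "grounding_subst fa (lpad_vars C) \<theta>" for C \<theta>
    using that by (force simp: f(2) choices_def D_def lpad_insts_def)
  ultimately show ?L
    unfolding selection_def by blast
qed

lemma choices_subset_iff:
  assumes "E \<subseteq> D"
  shows "choices f E \<subseteq> choices g D \<longleftrightarrow> (\<forall>i\<in>E. g i = f i)"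
  using assms by (force simp: choices_def)

lemma world_choices:
  assumes "\<forall>i\<in>D. f i < length (inst_heads i)"
  shows "world (choices f D) = (\<lambda>i. (inst_heads i ! f i, inst_body i)) ` D"
proof -
  have "inst_heads i ! f i = subst_atom (snd i) (lpad_heads (fst i) ! f i)" if "i \<in> D" for i
    using assms that by (auto simp: inst_heads_def)
  then show ?thesis
    unfolding world_def choices_def by (force simp: inst_body_def)
qed

lemma sound_bounded_lpad_insts:
  fixes T :: "('p, 'f::finite, 'v) lpad"
  assumes T: "wf_lpad fa T" and sound: "sound_lpad fa T" and bnd: "lpad_bounded_term_size fa T"
  shows "sound_bounded_lpad fa (lpad_insts fa T) inst_heads inst_body fst"
proof -
  interpret ground_lpad fa "lpad_insts fa T" inst_heads inst_body fst
    by (rule ground_lpad_insts[OF T])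
  have prog: "prog f \<in> worlds fa T" if "sel f" for f
  proof -
    have "prog f = world (choices f (lpad_insts fa T))"
      using that by (simp add: world_choices sel_def prog_def inst_def[abs_def])
    then show ?thesis
      using that selection_choices[OF T] unfolding worlds_def sel_def by blast
  qed
  show ?thesis
  proof unfold_locales
    show "gatoms fa \<subseteq> fst (WFM fa (prog f)) \<union> snd (WFM fa (prog f))" if "sel f" for f
      using sound prog[OF that] by (simp add: sound_lpad_def)
    fix f assume f: "sel f"
    have bounded: "bounded_term_size fa (prog f)"
      using bnd prog[OF f] by (simp add: lpad_bounded_term_size_def)
    obtain L where L: "\<And>I h ls. wfm_stage fa (prog f) I \<Longrightarrow> (h, ls) \<in> prog f \<Longrightarrow> h \<notin> fst I
      \<Longrightarrow> \<forall>l\<in>set ls. lit_true (derivable (prog f) (snd I), snd I) l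
      \<Longrightarrow> clause_size (h, ls) \<le> L"
      by (rule bounded_term_size_ground[OF ground_prog_prog[OF f] bounded]) blast
    let ?A = "\<lambda>b. {a. (\<exists>\<theta>. a = subst_atom \<theta> b) \<and> a \<in> gatoms fa
      \<and> (\<forall>t\<in>set (atom_terms a). tsize t \<le> L)}"
    \<comment> \<open>\<open>Null\<close> joins the atoms of \<open>T\<close> because a selection
      may choose the implicit head.\<close>
    let ?S = "insert Null (\<Union>C\<in>T. lpad_atoms C)"
    define B where "B = (\<Union>b\<in>?S. ?A b)"
    have "finite ?S"
      using T by (auto simp: wf_lpad_def lpad_atoms_def)
    then have fin: "finite B"
      unfolding B_def using finite_bounded_instances by (intro finite_UN_I) auto
    have *: "insert (inst_heads i ! f i) (lit_atom ` set (inst_body i)) \<subseteq> B"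
      if I: "wfm_stage fa (prog f) I" and i: "i \<in> lpad_insts fa T"
        and h: "inst_heads i ! f i \<notin> fst I"
        and l: "\<forall>l\<in>set (inst_body i). lit_true (derivable (prog f) (snd I), snd I) l" for I i
    proof
      fix a assume a: "a \<in> insert (inst_heads i ! f i) (lit_atom ` set (inst_body i))"
      have size: "clause_size (inst_heads i ! f i, inst_body i) \<le> L"
        by (rule L[OF I _ h l]) (use i in \<open>auto simp: prog_def inst_def\<close>)
      have fi: "f i < length (inst_heads i)"
        using f i by (simp add: sel_def)
      then have hd: "inst_heads i ! f i = subst_atom (snd i) (lpad_heads (fst i) ! f i)"
        "lpad_heads (fst i) ! f i \<in> set (lpad_heads (fst i))"
        by (auto simp: inst_heads_def)
      have "\<exists>b\<in>insert Null (lpad_atoms (fst i)). a = subst_atom (snd i) b"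
      proof (cases "a = inst_heads i ! f i")
        case True
        then show ?thesis
          using hd set_lpad_heads by blast
      next
        case False
        then show ?thesis
          using a by (auto simp: inst_body_def lpad_atoms_def)
      qed
      moreover have "fst i \<in> T"
        using i by (auto simp: lpad_insts_def)
      ultimately obtain b where b: "b \<in> ?S" "a = subst_atom (snd i) b"
        by blast
      have "a \<in> gatoms fa"
        using a gatoms_hds[OF i] gatoms_body[OF i] fi nth_mem by blast
      moreover have "tsize t \<le> L" if "t \<in> set (atom_terms a)" for t
        using tsize_le_clause_size[of a "(inst_heads i ! f i, inst_body i)" t] a that size by auto
      ultimately show "a \<in> B"
        using b unfolding B_def by blast
    qed
    show "\<exists>B. finite B \<and> (\<forall>I i. wfm_stage fa (prog f) I \<longrightarrow> i \<in> lpad_insts fa T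
      \<longrightarrow> inst_heads i ! f i \<notin> fst I
      \<longrightarrow> (\<forall>l\<in>set (inst_body i). lit_true (derivable (prog f) (snd I), snd I) l)
      \<longrightarrow> inst_heads i ! f i \<in> B \<and> lit_atom ` set (inst_body i) \<subseteq> B)"
    proof (intro exI[of _ B] conjI[OF fin] allI impI)
      fix I i
      assume "wfm_stage fa (prog f) I" "i \<in> lpad_insts fa T" "inst_heads i ! f i \<notin> fst I"
        "\<forall>l\<in>set (inst_body i). lit_true (derivable (prog f) (snd I), snd I) l"
      from *[OF this] show "inst_heads i ! f i \<in> B \<and> lit_atom ` set (inst_body i) \<subseteq> B"
        by simp
    qed
  qed
qed

section \<open>Covering sets of explanations\<close>

theorem theorem2:
  fixes fa :: "'f::finite \<Rightarrow> nat"
    and T :: "('p, 'f, 'v) lpad"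
    and A :: "('p, 'f, 'v) atom"
  assumes "wf_lpad fa T"
    and "sound_lpad fa T"
    and "lpad_bounded_term_size fa T"
    and "A \<in> herbrand_base fa T"
  shows "\<exists>K. finite K \<and> (\<forall>\<kappa>\<in>K. finite \<kappa> \<and> explanation fa T \<kappa> A) \<and> covering fa T K A"
proof -
  let ?D = "lpad_insts fa T"
  interpret sound_bounded_lpad fa ?D inst_heads inst_body fst
    using assms by (intro sound_bounded_lpad_insts)
  have selection_iff: "selection fa T \<sigma> \<longleftrightarrow> (\<exists>g. sel g \<and> \<sigma> = choices g ?D)" for \<sigma>
    unfolding sel_def by (rule selection_choices[OF assms(1)])
  have WFM_world: "fst (WFM fa (world (choices g ?D))) = M g" if "sel g" for g
    using that by (simp add: world_choices sel_def M_def prog_def inst_def[abs_def])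
  obtain F \<kappa> where F: "finite F" "\<And>f. f \<in> F \<Longrightarrow> sel f"
    "\<And>f. f \<in> F \<Longrightarrow> \<kappa> f \<subseteq> ?D \<and> finite (\<kappa> f)"
    "\<And>f g. f \<in> F \<Longrightarrow> sel g \<Longrightarrow> \<forall>i\<in>\<kappa> f. g i = f i \<Longrightarrow> M g = M f"
    "\<And>g. sel g \<Longrightarrow> \<exists>f\<in>F. \<forall>i\<in>\<kappa> f. g i = f i"
    by (rule finite_determining_family) blast
  \<comment> \<open>A world may arise from several selections, so membership only provides some
    selection \<open>g\<close> that extends the partial choice.\<close>
  have omega_iff: "w \<in> omega fa T (choices f (\<kappa> f)) \<longleftrightarrow>
      (\<exists>g. sel g \<and> (\<forall>i\<in>\<kappa> f. g i = f i) \<and> w = world (choices g ?D))" if "f \<in> F" for f w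
    using choices_subset_iff F(3)[OF that] unfolding omega_def selection_iff by blast
  \<comment> \<open>Every selection has the model of some \<open>f\<close> in \<open>F\<close> that
    it agrees with on \<open>\<kappa> f\<close>, so the partial choices of those \<open>f\<close>
    with \<open>A\<close> true in \<open>M f\<close> cover all worlds where \<open>A\<close> is
    true.\<close>
  let ?K = "(\<lambda>f. choices f (\<kappa> f)) ` {f \<in> F. A \<in> M f}"
  have "finite ?K"
    using F(1) by simp
  moreover have "finite (choices f (\<kappa> f)) \<and> explanation fa T (choices f (\<kappa> f)) A"
    if f: "f \<in> F" "A \<in> M f" for f
  proof -
    have "composite_choice fa T (choices f (\<kappa> f))"
      using F(2,3)[OF f(1)] by (intro composite_choice_choices) (auto simp: sel_def)
    moreover have "A \<in> fst (WFM fa w)" if "w \<in> omega fa T (choices f (\<kappa> f))" for w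
      using that f F(4) WFM_world unfolding omega_iff[OF f(1)] by metis
    moreover have "finite (choices f (\<kappa> f))"
      using F(3)[OF f(1)] by (simp add: choices_def)
    ultimately show ?thesis
      by (simp add: explanation_def)
  qed
  moreover have "covering fa T ?K A"
    unfolding covering_def
  proof (intro ballI impI)
    fix w assume w: "w \<in> worlds fa T" "A \<in> fst (WFM fa w)"
    then obtain g where g: "sel g" "w = world (choices g ?D)"
      unfolding worlds_def selection_iff by blast
    obtain f where f: "f \<in> F" "\<forall>i\<in>\<kappa> f. g i = f i"
      using F(5)[OF g(1)] by blast
    then have "A \<in> M f"
      using F(4)[OF f(1) g(1) f(2)] w(2) WFM_world[OF g(1)] g(2) by simp
    moreover have "w \<in> omega fa T (choices f (\<kappa> f))"
      using omega_iff[OF f(1)] g f(2) by blast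
    ultimately show "w \<in> (\<Union>\<kappa>\<in>?K. omega fa T \<kappa>)"
      using f(1) by blast
  qed
  ultimately show ?thesis
    by (intro exI[of _ ?K]) blast
qed

end
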